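(* Let $G$ be a connected strongly regular graph with parameters $(n,d,\lambda,\mu)$. Then the following are determined by the adjacency spectrum of $G$: the property of being strongly regular, the parameter vector $(n,d,\lambda,\mu)$, the Lovász $\vartheta$-function $\vartheta(G)$, the number of edges, the number of triangles, the girth, and the diameter. That is, every graph $H$ whose adjacency matrix has the same multiset of eigenvalues as that of $G$ is strongly regular with the same parameters $(n,d,\lambda,\mu)$, and $H$ has the same Lovász $\vartheta$-function, number of edges, number of triangles, girth and diameter as $G$.
   Context: All graphs are finite, simple and undirected. A graph is strongly regular with parameters $(n,d,\lambda,\mu)$ if it is $d$-regular on $n$ vertices, is neither complete nor edgeless, every two adjacent vertices have exactly $\lambda$ common neighbours, and every two distinct nonadjacent vertices have exactly $\mu$ common neighbours. The Lovász $\vartheta$-function of a graph $G$ with vertex set $V$ is $\vartheta(G)=\min_{c,\{u_i\}} \max_{i\in V} 1/(c^{\mathrm T}u_i)^2$, the minimum over unit vectors $c$ and orthonormal representations $\{u_i\}$ of $G$ (assignments of unit vectors $u_i$ to vertices such that $u_i^{\mathrm T}u_j=0$ whenever $i\ne j$ are nonadjacent). The girth is the length of a shortest cycle, and the diameter is the maximum distance between two vertices. *)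

theory Defs
  imports
    "Graph_Theory.Digraph_Component"
    "Graph_Theory.Shortest_Path"
    "Jordan_Normal_Form.Char_Poly"
    "HOL-Library.Extended_Nonnegative_Real"
    "HOL-Library.Extended_Nat"
begin

text \<open>
  Finite simple undirected graphs are the symmetric digraphs satisfying \<^const>\<open>graph\<close>:
  finitely many vertices and arcs, no loops, no parallel arcs, every arc having a reverse.
  Each undirected edge is thus a pair of opposite arcs.
\<close>

definition neighbours :: "('a, 'b) pre_digraph \<Rightarrow> 'a \<Rightarrow> 'a set" where
  "neighbours G v = {w. v \<rightarrow>\<^bsub>G\<^esub> w}"

definition strongly_regular ::
  "('a, 'b) pre_digraph \<Rightarrow> nat \<Rightarrow> nat \<Rightarrow> nat \<Rightarrow> nat \<Rightarrow> bool" where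
  "strongly_regular G n d lam mu \<longleftrightarrow>
     graph G \<and>
     card (verts G) = n \<and>
     (\<forall>v \<in> verts G. card (neighbours G v) = d) \<and>
     \<not> (\<forall>u \<in> verts G. \<forall>v \<in> verts G. u \<noteq> v \<longrightarrow> u \<rightarrow>\<^bsub>G\<^esub> v) \<and>
     arcs G \<noteq> {} \<and>
     (\<forall>u \<in> verts G. \<forall>v \<in> verts G. u \<rightarrow>\<^bsub>G\<^esub> v \<longrightarrow>
        card (neighbours G u \<inter> neighbours G v) = lam) \<and>
     (\<forall>u \<in> verts G. \<forall>v \<in> verts G. u \<noteq> v \<and> \<not> u \<rightarrow>\<^bsub>G\<^esub> v \<longrightarrow>
        card (neighbours G u \<inter> neighbours G v) = mu)"

definition adjacency_matrix :: "('a, 'b) pre_digraph \<Rightarrow> 'a list \<Rightarrow> complex mat" where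
  "adjacency_matrix G vs =
     mat (length vs) (length vs) (\<lambda>(i, j). if vs ! i \<rightarrow>\<^bsub>G\<^esub> vs ! j then 1 else 0)"

text \<open>
  Eigenvalues are counted with their multiplicity as roots of the characteristic polynomial.
  The matrix has complex entries so that the multiset visibly has as many elements as the graph
  has vertices; adjacency matrices being real symmetric, all its elements are real. The choice of
  the enumeration of the vertices is immaterial, see \<open>adjacency_spectrum_eq\<close> below.
\<close>

definition adjacency_spectrum :: "('a, 'b) pre_digraph \<Rightarrow> complex multiset" where
  "adjacency_spectrum G =
     proots (char_poly (adjacency_matrix G (SOME vs. distinct vs \<and> set vs = verts G)))"

definition orthonormal_representation ::
  "('a, 'b) pre_digraph \<Rightarrow> nat \<Rightarrow> ('a \<Rightarrow> real vec) \<Rightarrow> bool" where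
  "orthonormal_representation G k u \<longleftrightarrow>
     (\<forall>i \<in> verts G. u i \<in> carrier_vec k \<and> u i \<bullet> u i = 1) \<and>
     (\<forall>i \<in> verts G. \<forall>j \<in> verts G. i \<noteq> j \<and> \<not> i \<rightarrow>\<^bsub>G\<^esub> j \<longrightarrow> u i \<bullet> u j = 0)"

text \<open>
  The dimension \<open>k\<close> of the representation is arbitrary. The quotient is taken in
  \<^typ>\<open>ennreal\<close>, where \<open>1 / 0 = \<infinity>\<close>; division of real numbers would yield \<open>0\<close> there.
  The infimum is the usual minimum: at most one dimension more than the number of vertices is ever
  needed, so it is attained by compactness.
\<close>

definition lovasz_theta :: "('a, 'b) pre_digraph \<Rightarrow> ennreal" where
  "lovasz_theta G =
     Inf {(SUP i \<in> verts G. 1 / ennreal ((c \<bullet> u i)\<^sup>2)) | k c u.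
            c \<in> carrier_vec k \<and> c \<bullet> c = 1 \<and> orthonormal_representation G k u}"

definition num_edges :: "('a, 'b) pre_digraph \<Rightarrow> nat" where
  "num_edges G = card {{u, v} | u v. u \<rightarrow>\<^bsub>G\<^esub> v}"

definition num_triangles :: "('a, 'b) pre_digraph \<Rightarrow> nat" where
  "num_triangles G =
     card {T. T \<subseteq> verts G \<and> card T = 3 \<and> (\<forall>u \<in> T. \<forall>v \<in> T. u \<noteq> v \<longrightarrow> u \<rightarrow>\<^bsub>G\<^esub> v)}"

text \<open>
  Walking along an edge and back is a \<^const>\<open>pre_digraph.cycle\<close> of length 2 of the symmetric
  digraph, but not a cycle of the undirected graph. The girth of a forest is \<open>\<infinity>\<close>.
\<close>

definition girth :: "('a, 'b) pre_digraph \<Rightarrow> enat" where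
  "girth G = (INF p \<in> {p. pre_digraph.cycle G p \<and> 3 \<le> length p}. enat (length p))"

text \<open>
  The distance is the least cost of a walk for unit weights; it is \<open>\<infinity>\<close> between vertices of
  different components.
\<close>

definition diameter :: "('a, 'b) pre_digraph \<Rightarrow> ereal" where
  "diameter G = (SUP u \<in> verts G. SUP v \<in> verts G. wf_digraph.\<mu> G (\<lambda>_. 1) u v)"

lemma char_poly_adjacency_matrix_enum:
  assumes "distinct vs" "distinct ws" "set vs = set ws"
  shows "char_poly (adjacency_matrix G vs) = char_poly (adjacency_matrix G ws)"
proof -
  define n where "n = length ws"
  have len: "length vs = n" "length ws = n"
    using distinct_card[OF assms(1)] distinct_card[OF assms(2)] assms(3) by (simp_all add: n_def)
  from assms have "mset vs = mset ws"
    by (simp add: set_eq_iff_mset_eq_distinct)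
  then obtain p where p: "p permutes {..<length ws}" "permute_list p ws = vs"
    by (rule mset_eq_permutation)
  have pn: "p permutes {0..<n}" using p(1) by (simp add: n_def lessThan_atLeast0)
  have nth: "vs ! i = ws ! p i" if "i < n" for i
    using that p by (auto simp: permute_list_nth n_def)
  have pless: "p i < n" if "i < n" for i
    using that permutes_in_image[OF pn, of i] by simp
  define M where "M = char_poly_matrix (adjacency_matrix G ws)"
  define M' where "M' = mat n n (\<lambda>(i, j). M $$ (p i, j))"
  have M: "M \<in> carrier_mat n n"
    by (simp add: M_def char_poly_matrix_def adjacency_matrix_def n_def)
  have M': "transpose_mat M' \<in> carrier_mat n n" by (simp add: M'_def)
  have eq: "char_poly_matrix (adjacency_matrix G vs) =
      transpose_mat (mat n n (\<lambda>(i, j). transpose_mat M' $$ (p i, j)))"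
    by (rule eq_matI)
      (auto simp: char_poly_matrix_def adjacency_matrix_def M_def M'_def len nth pless
        dest: permutes_inj[OF pn, THEN injD])
  have "det (char_poly_matrix (adjacency_matrix G vs)) =
      det (mat n n (\<lambda>(i, j). transpose_mat M' $$ (p i, j)))"
    unfolding eq by (subst det_transpose) auto
  also have "\<dots> = signof p * det (transpose_mat M')"
    by (rule det_permute_rows[OF M' pn])
  also have "det (transpose_mat M') = det M'"
    by (rule det_transpose[of _ n]) (simp add: M'_def)
  also have "det M' = signof p * det M"
    unfolding M'_def by (rule det_permute_rows[OF M pn])
  finally show ?thesis
    by (simp add: char_poly_def M_def sign_def)
qed

lemma adjacency_spectrum_eq:
  assumes "distinct vs" "set vs = verts G"
  shows "adjacency_spectrum G = proots (char_poly (adjacency_matrix G vs))"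
proof -
  define ws where "ws = (SOME vs. distinct vs \<and> set vs = verts G)"
  have "distinct ws \<and> set ws = verts G"
    unfolding ws_def by (rule someI[of _ vs]) (use assms in simp)
  then have "char_poly (adjacency_matrix G ws) = char_poly (adjacency_matrix G vs)"
    using assms by (intro char_poly_adjacency_matrix_enum) auto
  then show ?thesis by (simp add: adjacency_spectrum_def ws_def)
qed

end

theory Submission
  imports Defs "Jordan_Normal_Form.Schur_Decomposition"
begin

text \<open>
  Let \<open>A\<close> be the adjacency matrix of a graph cospectral with \<open>G\<close>. The squared Frobenius norm of
  \<open>A\<^sup>2 - (\<lambda> - \<mu>) A - (d - \<mu>) I - \<mu> J\<close> is a combination of traces of powers of \<open>A\<close>, which are
  determined by the spectrum, minus \<open>2 \<mu>\<close> times the sum of the squared degrees. For \<open>G\<close> it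
  vanishes, and among graphs with the same number of vertices and edges the sum of the squared
  degrees is least for regular graphs. Hence it is \<open>\<le> 0\<close> for every cospectral graph, so the matrix
  vanishes there too, which says that the graph is strongly regular with the same parameters.

  The other invariants are functions of the parameters. If \<open>r \<ge> 0 > s\<close> are the restricted
  eigenvalues, then \<open>\<vartheta>(G) = - n s / (d - s)\<close>: the Gram matrix \<open>(A - s I) / (- s)\<close> gives an
  orthonormal representation attaining this value, and the Gram matrix \<open>(J - A + r I) / (1 + r)\<close>
  one of the complement, whose tensor product with any representation of \<open>G\<close> is an orthonormal
  family, to which Bessel's inequality applies. Connectedness gives \<open>\<mu> > 0\<close>; the diameter is then
  2, and the girth is 3, 4 or 5 according to whether \<open>\<lambda> > 0\<close>, or else \<open>\<mu> \<ge> 2\<close>, or else \<open>\<mu> = 1\<close>.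
\<close>

section \<open>Traces of matrix powers as power sums of the eigenvalues\<close>

definition mtrace :: "'a::comm_ring_1 mat \<Rightarrow> 'a" where
  "mtrace A = (\<Sum>i<dim_row A. A $$ (i, i))"

lemma mult_mat_nth:
  assumes "A \<in> carrier_mat n m" "B \<in> carrier_mat m k" "i < n" "j < k"
  shows "(A * B) $$ (i, j) = (\<Sum>l<m. A $$ (i, l) * B $$ (l, j))"
  using assms by (auto simp: scalar_prod_def lessThan_atLeast0 intro!: sum.cong)

lemma mtrace_mult:
  assumes "A \<in> carrier_mat n m" "B \<in> carrier_mat m n"
  shows "mtrace (A * B) = (\<Sum>i<n. \<Sum>j<m. A $$ (i, j) * B $$ (j, i))"
  using assms by (auto simp: mtrace_def mult_mat_nth simp del: index_mult_mat(1) intro!: sum.cong)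

lemma mtrace_mult_commute:
  assumes "A \<in> carrier_mat n m" "B \<in> carrier_mat m n"
  shows "mtrace (A * B) = mtrace (B * A)"
  unfolding mtrace_mult[OF assms] mtrace_mult[OF assms(2,1)]
  by (subst sum.swap) (simp add: mult.commute)

text \<open>\<open>A = P * B * Q\<close> where \<open>Q * P\<close> is the identity, and the trace
  is invariant under cyclic shifts of a product.\<close>

lemma mtrace_similar_mat_wit:
  assumes "A \<in> carrier_mat n n" "similar_mat_wit A B P Q"
  shows "mtrace A = mtrace B"
proof -
  note w = similar_mat_witD2[OF assms]
  have "mtrace A = mtrace (P * (B * Q))"
    using w by (simp add: assoc_mult_mat[of P n n B n Q n])
  also have "\<dots> = mtrace (B * Q * P)"
    using w by (intro mtrace_mult_commute[of _ n n]) auto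
  also have "B * Q * P = B * (Q * P)"
    using w by (intro assoc_mult_mat) auto
  also have "\<dots> = B" using w by simp
  finally show ?thesis .
qed

text \<open>One induction carries both claims, because the diagonal entry of
  \<open>B ^\<^sub>m k * B\<close> collapses to a single product only once
  \<open>B ^\<^sub>m k\<close> is known to be upper triangular.\<close>

lemma upper_triangular_pow:
  fixes B :: "'a::comm_ring_1 mat"
  assumes B: "B \<in> carrier_mat n n" and ut: "upper_triangular B"
  shows "upper_triangular (B ^\<^sub>m k) \<and> (\<forall>i<n. (B ^\<^sub>m k) $$ (i, i) = (B $$ (i, i)) ^ k)"
proof (induction k)
  case 0
  then show ?case using B by auto
next
  case (Suc k)
  let ?C = "B ^\<^sub>m k"
  have C: "?C \<in> carrier_mat n n" using B by simp
  have "?C $$ (i, l) * B $$ (l, j) = 0" if "j < i" "i < n" "l < n" for i j l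
    using that Suc.IH ut B C by (cases "l < i") (auto simp: upper_triangular_def)
  then have 1: "(?C * B) $$ (i, j) = 0" if "j < i" "i < n" for i j
    using that unfolding mult_mat_nth[OF C B that(2) less_trans[OF that]]
    by (intro sum.neutral) auto
  have "?C $$ (i, l) * B $$ (l, i) = (if l = i then ?C $$ (i, i) * B $$ (i, i) else 0)"
    if "i < n" "l < n" for i l
    using that Suc.IH ut B C by (cases l i rule: linorder_cases) (auto simp: upper_triangular_def)
  then have 2: "(?C * B) $$ (i, i) = (B $$ (i, i)) ^ Suc k" if "i < n" for i
    using that Suc.IH unfolding mult_mat_nth[OF C B that that] by (simp add: mult.commute)
  show ?case using 1 2 B by (auto simp del: index_mult_mat(1))
qed

text \<open>Schur decomposition makes \<open>A\<close> similar to an upper triangular matrix with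
  diagonal \<open>es\<close>. The similarity passes to powers, whose diagonals consist of the powers
  of the entries of \<open>es\<close>.\<close>

lemma mtrace_pow_eq_power_sum:
  fixes A :: "complex mat"
  assumes A: "A \<in> carrier_mat n n" and cp: "char_poly A = (\<Prod>e\<leftarrow>es. [:- e, 1:])"
  shows "mtrace (A ^\<^sub>m k) = (\<Sum>e\<leftarrow>es. e ^ k)"
proof -
  obtain B P Q where dec: "schur_decomposition A es = (B, P, Q)"
    using prod_cases3 by blast
  from schur_decomposition[OF A cp dec]
  have w: "similar_mat_wit A B P Q" and ut: "upper_triangular B" and diag: "diag_mat B = es"
    by auto
  have B: "B \<in> carrier_mat n n" using similar_mat_witD2[OF A w] by simp
  have "mtrace (A ^\<^sub>m k) = mtrace (B ^\<^sub>m k)"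
    using A by (intro mtrace_similar_mat_wit[OF _ similar_mat_wit_pow[OF w]]) auto
  also have "\<dots> = (\<Sum>i<n. (B $$ (i, i)) ^ k)"
    using upper_triangular_pow[OF B ut, of k] B by (auto simp: mtrace_def)
  also have "\<dots> = (\<Sum>e\<leftarrow>diag_mat B. e ^ k)"
    using B by (simp add: diag_mat_def sum_list_distinct_conv_sum_set comp_def
        lessThan_atLeast0)
  finally show ?thesis by (simp add: diag)
qed

text \<open>Over the complex numbers the characteristic polynomial splits, so its multiset of roots
  recovers the list of eigenvalues up to order. The dimension is the length of this list, and power
  sums do not depend on the order.\<close>

lemma mtrace_pow_eq_if_proots_eq:
  fixes A B :: "complex mat"
  assumes A: "A \<in> carrier_mat n n" and B: "B \<in> carrier_mat m m"
    and eq: "proots (char_poly A) = proots (char_poly B)"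
  shows "n = m" and "mtrace (A ^\<^sub>m k) = mtrace (B ^\<^sub>m k)"
proof -
  from char_poly_factorized[OF A] obtain as
    where as: "char_poly A = (\<Prod>a\<leftarrow>as. [:- a, 1:])" "length as = n" by blast
  from char_poly_factorized[OF B] obtain bs
    where bs: "char_poly B = (\<Prod>a\<leftarrow>bs. [:- a, 1:])" "length bs = m" by blast
  have proots: "proots (\<Prod>a\<leftarrow>cs. [:- a, 1:]) = mset cs" for cs :: "complex list"
  proof (induction cs)
    case (Cons c cs)
    have "(\<Prod>a\<leftarrow>cs. [:- a, 1:]) \<noteq> 0" by (auto simp: prod_list_zero_iff)
    then show ?case using Cons by (simp add: proots_mult del: mult_pCons_left)
  qed simp
  have "mset as = mset bs" using eq as bs proots by simp
  then have "(\<Sum>e\<leftarrow>as. e ^ k) = (\<Sum>e\<leftarrow>bs. e ^ k)" "length as = length bs"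
    by (metis mset_map sum_mset_sum_list, metis size_mset)
  then show "n = m" "mtrace (A ^\<^sub>m k) = mtrace (B ^\<^sub>m k)"
    using as bs mtrace_pow_eq_power_sum[OF A as(1)] mtrace_pow_eq_power_sum[OF B bs(1)] by auto
qed

section \<open>Spectral sums over vertices: closed walks of length 2, 3 and 4\<close>

text \<open>Indexed by vertices and real-valued, unlike \<open>adjacency_matrix\<close>, so that
  sums need no enumeration of the vertices and inequalities make sense.\<close>

definition adj :: "('a, 'b) pre_digraph \<Rightarrow> 'a \<Rightarrow> 'a \<Rightarrow> real" where
  "adj G u v = (if u \<rightarrow>\<^bsub>G\<^esub> v then 1 else 0)"

text \<open>The entry of the squared adjacency matrix, that is, the number of walks of length two.
  In a symmetric graph it counts the common neighbours.\<close>

definition codeg :: "('a, 'b) pre_digraph \<Rightarrow> 'a \<Rightarrow> 'a \<Rightarrow> real" where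
  "codeg G u v = (\<Sum>w\<in>verts G. adj G u w * adj G w v)"

lemma sum_nth_distinct:
  assumes "distinct vs"
  shows "(\<Sum>i<length vs. f (vs ! i)) = sum f (set vs)"
  using assms by (simp add: sum_list_distinct_conv_sum_set[symmetric] sum_list_sum_nth
      lessThan_atLeast0)

text \<open>Exponents up to 4 suffice later, because the defect of strong regularity is quadratic in
  the adjacency matrix and gets squared. The fourth power is grouped as a product of two squares, so
  that only \<open>codeg\<close> occurs.\<close>

lemma mtrace_adjacency_matrix_pow:
  assumes vs: "distinct vs" "set vs = verts G"
  defines "A \<equiv> adjacency_matrix G vs"
  shows "mtrace (A ^\<^sub>m 2) = of_real (\<Sum>u\<in>verts G. \<Sum>v\<in>verts G. adj G u v * adj G v u)"
    and "mtrace (A ^\<^sub>m 3) = of_real (\<Sum>u\<in>verts G. \<Sum>v\<in>verts G. codeg G u v * adj G v u)"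
    and "mtrace (A ^\<^sub>m 4) = of_real (\<Sum>u\<in>verts G. \<Sum>v\<in>verts G. codeg G u v * codeg G v u)"
proof -
  define n where "n = length vs"
  have A: "A \<in> carrier_mat n n" by (simp add: A_def adjacency_matrix_def n_def)
  then have AA: "A * A \<in> carrier_mat n n" by simp
  have sum2: "(\<Sum>i<n. \<Sum>j<n. f (vs ! i) (vs ! j)) = (\<Sum>u\<in>verts G. \<Sum>v\<in>verts G. f u v)"
    for f :: "_ \<Rightarrow> _ \<Rightarrow> real"
    using sum_nth_distinct[OF vs(1), of "\<lambda>u. \<Sum>j<n. f u (vs ! j)"]
      sum_nth_distinct[OF vs(1), of "f u" for u] vs(2) by (simp add: n_def)
  have a: "A $$ (i, j) = of_real (adj G (vs ! i) (vs ! j))" if "i < n" "j < n" for i j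
    using that by (simp add: A_def adjacency_matrix_def n_def adj_def)
  have c: "(A * A) $$ (i, j) = of_real (codeg G (vs ! i) (vs ! j))" if "i < n" "j < n" for i j
    using that sum_nth_distinct[OF vs(1), of "\<lambda>w. adj G (vs ! i) w * adj G w (vs ! j)"] vs(2)
    unfolding mult_mat_nth[OF A A that] by (simp add: a codeg_def n_def flip: of_real_mult of_real_sum)
  have "A ^\<^sub>m 2 = A * A" using A by (simp add: numeral_eq_Suc)
  then show "mtrace (A ^\<^sub>m 2) = of_real (\<Sum>u\<in>verts G. \<Sum>v\<in>verts G. adj G u v * adj G v u)"
    by (simp add: mtrace_mult[OF A A] a sum2[of "\<lambda>u v. adj G u v * adj G v u"] flip: of_real_mult of_real_sum)
  have "A ^\<^sub>m 3 = (A * A) * A" using A by (simp add: numeral_eq_Suc)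
  then show "mtrace (A ^\<^sub>m 3) = of_real (\<Sum>u\<in>verts G. \<Sum>v\<in>verts G. codeg G u v * adj G v u)"
    by (simp add: mtrace_mult[OF AA A] a c sum2[of "\<lambda>u v. codeg G u v * adj G v u"] flip: of_real_mult of_real_sum del: index_mult_mat(1))
  have "A ^\<^sub>m 4 = (A * A) * (A * A)" using A assoc_mult_mat[OF AA A A] by (simp add: numeral_eq_Suc)
  then show "mtrace (A ^\<^sub>m 4) = of_real (\<Sum>u\<in>verts G. \<Sum>v\<in>verts G. codeg G u v * codeg G v u)"
    by (simp add: mtrace_mult[OF AA AA] c sum2[of "\<lambda>u v. codeg G u v * codeg G v u"] flip: of_real_mult of_real_sum del: index_mult_mat(1))
qed

lemma cospectral_closed_walks:
  assumes "finite (verts G)" "finite (verts H)" "adjacency_spectrum H = adjacency_spectrum G"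
  shows "card (verts H) = card (verts G)"
    and "(\<Sum>u\<in>verts H. \<Sum>v\<in>verts H. adj H u v * adj H v u)
       = (\<Sum>u\<in>verts G. \<Sum>v\<in>verts G. adj G u v * adj G v u)"
    and "(\<Sum>u\<in>verts H. \<Sum>v\<in>verts H. codeg H u v * adj H v u)
       = (\<Sum>u\<in>verts G. \<Sum>v\<in>verts G. codeg G u v * adj G v u)"
    and "(\<Sum>u\<in>verts H. \<Sum>v\<in>verts H. codeg H u v * codeg H v u)
       = (\<Sum>u\<in>verts G. \<Sum>v\<in>verts G. codeg G u v * codeg G v u)"
proof -
  obtain vs where vs: "distinct vs" "set vs = verts G"
    using assms(1) finite_distinct_list by metis
  obtain ws where ws: "distinct ws" "set ws = verts H"
    using assms(2) finite_distinct_list by metis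
  have A: "adjacency_matrix G vs \<in> carrier_mat (length vs) (length vs)"
    and B: "adjacency_matrix H ws \<in> carrier_mat (length ws) (length ws)"
    by (simp_all add: adjacency_matrix_def)
  have eq: "proots (char_poly (adjacency_matrix H ws)) = proots (char_poly (adjacency_matrix G vs))"
    using assms(3) adjacency_spectrum_eq[OF vs] adjacency_spectrum_eq[OF ws] by simp
  show "card (verts H) = card (verts G)"
    using mtrace_pow_eq_if_proots_eq(1)[OF B A eq] vs ws distinct_card by metis
  note tr = mtrace_pow_eq_if_proots_eq(2)[OF B A eq]
  show "(\<Sum>u\<in>verts H. \<Sum>v\<in>verts H. adj H u v * adj H v u)
       = (\<Sum>u\<in>verts G. \<Sum>v\<in>verts G. adj G u v * adj G v u)"
    using tr[of 2] unfolding mtrace_adjacency_matrix_pow[OF vs] mtrace_adjacency_matrix_pow[OF ws]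
    by (simp only: of_real_eq_iff)
  show "(\<Sum>u\<in>verts H. \<Sum>v\<in>verts H. codeg H u v * adj H v u)
       = (\<Sum>u\<in>verts G. \<Sum>v\<in>verts G. codeg G u v * adj G v u)"
    using tr[of 3] unfolding mtrace_adjacency_matrix_pow[OF vs] mtrace_adjacency_matrix_pow[OF ws]
    by (simp only: of_real_eq_iff)
  show "(\<Sum>u\<in>verts H. \<Sum>v\<in>verts H. codeg H u v * codeg H v u)
       = (\<Sum>u\<in>verts G. \<Sum>v\<in>verts G. codeg G u v * codeg G v u)"
    using tr[of 4] unfolding mtrace_adjacency_matrix_pow[OF vs] mtrace_adjacency_matrix_pow[OF ws]
    by (simp only: of_real_eq_iff)
qed

section \<open>The matrix equation of strong regularity\<close>

text \<open>The entry at \<open>(u, v)\<close> of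
  \<open>A^2 - (lam - mu) A - (d - mu) I - mu J\<close>, where \<open>A\<close> is the adjacency
  matrix and \<open>J\<close> the all-ones matrix.\<close>

definition srg_defect :: "('a, 'b) pre_digraph \<Rightarrow> real \<Rightarrow> real \<Rightarrow> real \<Rightarrow> 'a \<Rightarrow> 'a \<Rightarrow> real" where
  "srg_defect G d lam mu u v =
     codeg G u v - (lam - mu) * adj G u v - (d - mu) * of_bool (u = v) - mu"

lemma (in graph) adj_commute: "adj G u v = adj G v u"
  using sym_arcs by (auto simp: adj_def symmetric_def dest: symD)

lemma (in graph) dominates_irrefl: "\<not> u \<rightarrow>\<^bsub>G\<^esub> u"
  using no_loops by (auto simp: arcs_ends_def arc_to_ends_def)

lemma (in graph) adj_self: "adj G u u = 0"
  by (simp add: adj_def dominates_irrefl)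

lemma (in graph) dominates_verts:
  "u \<rightarrow>\<^bsub>G\<^esub> v \<Longrightarrow> u \<in> verts G" "u \<rightarrow>\<^bsub>G\<^esub> v \<Longrightarrow> v \<in> verts G"
  by (auto simp: adj_in_verts)

lemma (in graph) finite_neighbours: "finite (neighbours G u)"
  by (rule finite_subset[OF _ finite_verts]) (auto simp: neighbours_def adj_in_verts)

lemma (in graph) sum_adj_eq_card: "(\<Sum>v\<in>verts G. adj G u v) = card (neighbours G u)"
proof -
  have "(\<Sum>v\<in>verts G. adj G u v) = (\<Sum>v\<in>neighbours G u. 1)"
    by (rule sum.mono_neutral_cong_right) (auto simp: adj_def neighbours_def adj_in_verts)
  then show ?thesis by simp
qed

lemma (in graph) codeg_eq_card: "codeg G u v = card (neighbours G u \<inter> neighbours G v)"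
proof -
  have "codeg G u v = (\<Sum>w\<in>neighbours G u \<inter> neighbours G v. 1)"
    unfolding codeg_def adj_commute[of _ v]
    by (rule sum.mono_neutral_cong_right) (auto simp: adj_def neighbours_def adj_in_verts)
  then show ?thesis by simp
qed

lemma (in graph) codeg_commute: "codeg G u v = codeg G v u"
  by (simp add: codeg_eq_card Int_commute)

text \<open>All sums on the right-hand side are spectral, except for the sum of the squared degrees.\<close>

lemma (in graph) sum_srg_defect_square:
  fixes d lam mu :: real
  shows "(\<Sum>u\<in>verts G. \<Sum>v\<in>verts G. (srg_defect G d lam mu u v)\<^sup>2) =
      (\<Sum>u\<in>verts G. \<Sum>v\<in>verts G. codeg G u v * codeg G v u)
    - 2 * (lam - mu) * (\<Sum>u\<in>verts G. \<Sum>v\<in>verts G. codeg G u v * adj G v u)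
    + ((lam - mu)\<^sup>2 - 2 * (d - mu) + 2 * (lam - mu) * mu) *
        (\<Sum>u\<in>verts G. \<Sum>v\<in>verts G. adj G u v * adj G v u)
    + ((d - mu)\<^sup>2 + 2 * (d - mu) * mu) * card (verts G) + mu\<^sup>2 * (card (verts G))\<^sup>2
    - 2 * mu * (\<Sum>w\<in>verts G. (\<Sum>u\<in>verts G. adj G w u)\<^sup>2)"
proof -
  define V where "V = verts G"
  define \<alpha> \<beta> where "\<alpha> = lam - mu" and "\<beta> = d - mu"
  have fin: "finite V" by (simp add: V_def)
  have sq: "adj G u v * adj G v u = adj G u v" for u v
    by (subst adj_commute[of v u]) (simp add: adj_def)
  \<comment> \<open>Since \<open>adj\<close> takes the values 0 and 1 and vanishes on the diagonal,
    its square is itself and its product with the identity disappears. The other terms with the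
    identity are collected in the last summand.\<close>
  have pt: "(srg_defect G d lam mu u v)\<^sup>2 =
      codeg G u v * codeg G v u - 2 * \<alpha> * (codeg G u v * adj G v u)
      + (\<alpha>\<^sup>2 + 2 * \<alpha> * mu) * adj G u v + mu\<^sup>2 - 2 * mu * codeg G u v
      + (if u = v then \<beta>\<^sup>2 + 2 * \<beta> * mu - 2 * \<beta> * codeg G u u else 0)" for u v
  proof -
    have "codeg G v u = codeg G u v" "adj G v u = adj G u v" "(adj G u v)\<^sup>2 = adj G u v"
      by (auto simp: codeg_commute adj_commute) (simp add: adj_def)
    then show ?thesis
      by (cases "u = v")
        (auto simp: srg_defect_def adj_self \<alpha>_def[symmetric] \<beta>_def[symmetric] power2_eq_square
          algebra_simps)
  qed
  have diag: "(\<Sum>u\<in>V. codeg G u u) = (\<Sum>u\<in>V. \<Sum>v\<in>V. adj G u v)"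
    by (simp add: codeg_def sq V_def)
  \<comment> \<open>Walks of length two are counted by their middle vertex.\<close>
  have deg: "(\<Sum>u\<in>V. \<Sum>v\<in>V. codeg G u v) = (\<Sum>w\<in>V. (\<Sum>u\<in>V. adj G w u)\<^sup>2)"
  proof -
    have "(\<Sum>u\<in>V. \<Sum>v\<in>V. codeg G u v) = (\<Sum>u\<in>V. \<Sum>w\<in>V. \<Sum>v\<in>V. adj G u w * adj G w v)"
      unfolding codeg_def V_def[symmetric] by (intro sum.cong refl sum.swap)
    also have "\<dots> = (\<Sum>w\<in>V. \<Sum>u\<in>V. \<Sum>v\<in>V. adj G w u * adj G w v)"
      by (subst sum.swap) (simp add: adj_commute)
    finally show ?thesis by (simp add: power2_eq_square sum_product)
  qed
  have "(\<Sum>u\<in>V. \<Sum>v\<in>V. (srg_defect G d lam mu u v)\<^sup>2) =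
      (\<Sum>u\<in>V. \<Sum>v\<in>V. codeg G u v * codeg G v u)
      - 2 * \<alpha> * (\<Sum>u\<in>V. \<Sum>v\<in>V. codeg G u v * adj G v u)
      + (\<alpha>\<^sup>2 + 2 * \<alpha> * mu) * (\<Sum>u\<in>V. \<Sum>v\<in>V. adj G u v) + mu\<^sup>2 * (card V)\<^sup>2
      - 2 * mu * (\<Sum>u\<in>V. \<Sum>v\<in>V. codeg G u v)
      + ((\<beta>\<^sup>2 + 2 * \<beta> * mu) * card V - 2 * \<beta> * (\<Sum>u\<in>V. codeg G u u))"
    unfolding pt using fin by (simp add: sum.distrib sum_subtractf sum_distrib_left[symmetric] sum.delta
        power2_eq_square)
  then show ?thesis
    unfolding deg diag sq unfolding \<alpha>_def \<beta>_def V_def by (simp add: algebra_simps)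
qed

text \<open>On the diagonal the defect compares the degree with \<open>d\<close>, on an edge the
  codegree with \<open>lam\<close>, and elsewhere the codegree with \<open>mu\<close>.\<close>

lemma strongly_regular_srg_defect_eq_0:
  assumes "strongly_regular G n d lam mu" "u \<in> verts G" "v \<in> verts G"
  shows "srg_defect G d lam mu u v = 0"
proof -
  interpret graph G using assms(1) by (simp add: strongly_regular_def)
  show ?thesis
    using assms adj_self[of u]
    by (auto simp: srg_defect_def codeg_eq_card strongly_regular_def adj_def split: if_splits)
qed

text \<open>Regularity is the diagonal part of the defect equation, and for a
  \<open>d\<close>-regular graph being neither edgeless nor complete is a pair of bounds on
  \<open>n * d\<close>. The right-hand side thus refers to the graph only through its order and its
  defect.\<close>

lemma (in graph) strongly_regular_iff_srg_defect:
  fixes n d lam mu :: nat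
  shows "strongly_regular G n d lam mu \<longleftrightarrow>
    card (verts G) = n \<and> 0 < n * d \<and> n * d < n * (n - 1) \<and>
    (\<forall>u\<in>verts G. \<forall>v\<in>verts G. srg_defect G d lam mu u v = 0)"
proof
  assume srg: "strongly_regular G n d lam mu"
  then have n: "card (verts G) = n" and d: "\<And>v. v \<in> verts G \<Longrightarrow> card (neighbours G v) = d"
    and ne: "arcs G \<noteq> {}"
    by (auto simp: strongly_regular_def)
  from ne obtain a where "a \<in> arcs G" by auto
  then have "tail G a \<rightarrow>\<^bsub>G\<^esub> head G a" by (rule in_arcs_imp_in_arcs_ends)
  then have "tail G a \<in> verts G" "neighbours G (tail G a) \<noteq> {}"
    by (auto simp: adj_in_verts neighbours_def)
  then have "0 < n" "0 < d"
    using n d[of "tail G a"] finite_neighbours[of "tail G a"] by (auto simp: card_gt_0_iff)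
  from srg obtain u v where uv: "u \<in> verts G" "v \<in> verts G" "u \<noteq> v" "\<not> u \<rightarrow>\<^bsub>G\<^esub> v"
    by (auto simp: strongly_regular_def)
  have "neighbours G u \<subseteq> verts G - {u, v}"
    using uv adj_self[of u] by (auto simp: neighbours_def adj_in_verts adj_def)
  from card_mono[OF _ this] have "d \<le> n - 2"
    using uv d n by simp
  \<comment> \<open>Subtraction of natural numbers is truncated, so \<open>d \<le> n - 2\<close>
    gives \<open>d < n - 1\<close> only together with this bound.\<close>
  moreover have "2 \<le> n" using card_mono[of "verts G" "{u, v}"] uv n by simp
  ultimately have "d < n - 1" by simp
  with \<open>0 < n\<close> \<open>0 < d\<close> n strongly_regular_srg_defect_eq_0[OF srg]
  show "card (verts G) = n \<and> 0 < n * d \<and> n * d < n * (n - 1) \<and>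
    (\<forall>u\<in>verts G. \<forall>v\<in>verts G. srg_defect G d lam mu u v = 0)" by simp
next
  assume asm: "card (verts G) = n \<and> 0 < n * d \<and> n * d < n * (n - 1) \<and>
    (\<forall>u\<in>verts G. \<forall>v\<in>verts G. srg_defect G d lam mu u v = 0)"
  then have n: "card (verts G) = n" "0 < n" "0 < d" "d < n - 1"
    and z: "\<And>u v. u \<in> verts G \<Longrightarrow> v \<in> verts G \<Longrightarrow> srg_defect G d lam mu u v = 0" by auto
  have deg: "card (neighbours G v) = d" if "v \<in> verts G" for v
    using z[OF that that] adj_self[of v] by (simp add: srg_defect_def codeg_eq_card)
  have lam: "card (neighbours G u \<inter> neighbours G v) = lam" if "u \<rightarrow>\<^bsub>G\<^esub> v" for u v
    using z[OF dominates_verts[OF that]] that adj_self[of v]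
    by (cases "u = v") (auto simp: srg_defect_def codeg_eq_card adj_def split: if_splits)
  have mu: "card (neighbours G u \<inter> neighbours G v) = mu"
    if "u \<in> verts G" "v \<in> verts G" "u \<noteq> v" "\<not> u \<rightarrow>\<^bsub>G\<^esub> v" for u v
    using z[OF that(1,2)] that by (simp add: srg_defect_def codeg_eq_card adj_def)
  obtain x where x: "x \<in> verts G" using n by fastforce
  then have "neighbours G x \<noteq> {}" using deg[OF x] n by auto
  then have ne: "arcs G \<noteq> {}" by (auto simp: neighbours_def arcs_ends_def)
  have nc: "\<not> (\<forall>u\<in>verts G. \<forall>v\<in>verts G. u \<noteq> v \<longrightarrow> u \<rightarrow>\<^bsub>G\<^esub> v)"
  proof
    assume "\<forall>u\<in>verts G. \<forall>v\<in>verts G. u \<noteq> v \<longrightarrow> u \<rightarrow>\<^bsub>G\<^esub> v"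
    then have "verts G - {x} \<subseteq> neighbours G x" using x by (auto simp: neighbours_def)
    from card_mono[OF finite_neighbours this] show False using x n deg by simp
  qed
  show "strongly_regular G n d lam mu"
    unfolding strongly_regular_def using graph_axioms n deg lam mu ne nc by auto
qed

section \<open>Strong regularity is determined by the spectrum\<close>

lemma (in graph) sum_adj_square: "(\<Sum>u\<in>verts G. \<Sum>v\<in>verts G. adj G u v * adj G v u)
    = (\<Sum>u\<in>verts G. card (neighbours G u))"
proof -
  have "adj G u v * adj G v u = adj G u v" for u v
    by (subst adj_commute[of v u]) (simp add: adj_def)
  then show ?thesis by (simp only: sum_adj_eq_card of_nat_sum)
qed

theorem strongly_regular_cospectral:
  assumes srg: "strongly_regular G n d lam mu" and H: "graph H"
    and spec: "adjacency_spectrum H = adjacency_spectrum G"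
  shows "strongly_regular H n d lam mu"
proof -
  interpret G: graph G using srg by (simp add: strongly_regular_def)
  interpret H: graph H by (rule H)
  note eqs = cospectral_closed_walks[OF G.finite_verts H.finite_verts spec]
  have G: "card (verts G) = n" "0 < n * d" "n * d < n * (n - 1)"
    "\<And>u v. u \<in> verts G \<Longrightarrow> v \<in> verts G \<Longrightarrow> srg_defect G d lam mu u v = 0"
    using srg G.strongly_regular_iff_srg_defect by auto
  have degG: "\<And>v. v \<in> verts G \<Longrightarrow> card (neighbours G v) = d"
    using srg by (simp add: strongly_regular_def)
  have sumH: "(\<Sum>u\<in>verts H. real (card (neighbours H u))) = n * d"
    using eqs(2) G(1) degG unfolding G.sum_adj_square H.sum_adj_square by simp
  \<comment> \<open>By \<open>sumH\<close> the mean degree of \<open>H\<close> is \<open>d\<close>,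
    so the deviations from \<open>d\<close> bound the sum of the squared degrees below by that of a
    \<open>d\<close>-regular graph.\<close>
  have "0 \<le> (\<Sum>u\<in>verts H. (real (card (neighbours H u)) - d)\<^sup>2)"
    by (intro sum_nonneg) auto
  also have "\<dots> = (\<Sum>u\<in>verts H. (real (card (neighbours H u)))\<^sup>2)
      - 2 * d * (\<Sum>u\<in>verts H. real (card (neighbours H u))) + n * d\<^sup>2"
    using eqs(1) G(1)
    by (simp add: power2_diff sum.distrib sum_subtractf sum_distrib_left mult.commute mult.left_commute)
  finally have D: "n * (real d)\<^sup>2 \<le> (\<Sum>u\<in>verts H. (real (card (neighbours H u)))\<^sup>2)"
    using sumH by (simp add: power2_eq_square[of "real d"] mult.commute mult.left_commute)
  \<comment> \<open>The spectral terms of both expansions cancel, leaving the sums of the squared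
    degrees. As \<open>mu\<close> is nonnegative, the bound \<open>D\<close> has the right
    direction.\<close>
  have "(\<Sum>u\<in>verts H. \<Sum>v\<in>verts H. (srg_defect H d lam mu u v)\<^sup>2)
      = (\<Sum>u\<in>verts G. \<Sum>v\<in>verts G. (srg_defect G d lam mu u v)\<^sup>2)
        + 2 * mu * ((\<Sum>u\<in>verts G. (real (card (neighbours G u)))\<^sup>2)
          - (\<Sum>u\<in>verts H. (real (card (neighbours H u)))\<^sup>2))"
    unfolding G.sum_srg_defect_square H.sum_srg_defect_square eqs
      G.sum_adj_eq_card H.sum_adj_eq_card
    by (simp add: algebra_simps)
  also have "\<dots> = 2 * mu * (n * (real d)\<^sup>2 - (\<Sum>u\<in>verts H. (real (card (neighbours H u)))\<^sup>2))"
    using G degG by simp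
  also have "\<dots> \<le> 0"
    using D by (intro mult_nonneg_nonpos) auto
  finally have "(\<Sum>u\<in>verts H. \<Sum>v\<in>verts H. (srg_defect H d lam mu u v)\<^sup>2) = 0"
    by (intro antisym sum_nonneg) auto
  then have "srg_defect H d lam mu u v = 0" if "u \<in> verts H" "v \<in> verts H" for u v
    using that by (simp add: sum_nonneg_eq_0_iff sum_nonneg)
  then show ?thesis
    using G eqs(1) H.strongly_regular_iff_srg_defect by auto
qed

section \<open>Vectors with prescribed inner products and bounds for the theta-function\<close>

text \<open>For symmetric \<open>K\<close> with \<open>K^2 = \<rho> K\<close> the columns of
  \<open>K\<close>, divided by the square root of \<open>\<rho>\<close>, have Gram matrix
  \<open>K\<close>, so no matrix square root is called for. One further coordinate, constant on all
  vectors, adds \<open>b\<close> to every inner product, and \<open>c\<close> is the unit vector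
  along it.\<close>

lemma gram_representation:
  fixes K :: "'a \<Rightarrow> 'a \<Rightarrow> real"
  assumes "finite V" and sym: "\<And>i j. K i j = K j i"
    and idem: "\<And>i j. i \<in> V \<Longrightarrow> j \<in> V \<Longrightarrow> (\<Sum>l\<in>V. K i l * K l j) = \<rho> * K i j"
    and pos: "\<rho> > 0" "b \<ge> 0" "m > 0"
  obtains k c x where "c \<in> carrier_vec k" "c \<bullet> c = 1"
    "\<And>i. x i \<in> carrier_vec k" "\<And>i. c \<bullet> x i = sqrt (b / m)"
    "\<And>i j. i \<in> V \<Longrightarrow> j \<in> V \<Longrightarrow> x i \<bullet> x j = (K i j + b) / m"
proof -
  obtain vs where vs: "distinct vs" "set vs = V"
    using \<open>finite V\<close> finite_distinct_list by metis
  define n where "n = length vs"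
  define x where "x i = vec (Suc n) (\<lambda>l. if l < n then K (vs ! l) i / sqrt (\<rho> * m) else sqrt (b / m))"
    for i
  define c :: "real vec" where "c = vec (Suc n) (\<lambda>l. if l < n then 0 else 1)"
  have "x i \<bullet> x j = (K i j + b) / m" if ij: "i \<in> V" "j \<in> V" for i j
  proof -
    have "x i \<bullet> x j = (\<Sum>l<n. K (vs ! l) i * K (vs ! l) j / (\<rho> * m)) + b / m"
      using pos by (simp add: scalar_prod_def x_def lessThan_atLeast0[symmetric] lessThan_Suc
          flip: real_sqrt_mult)
    also have "(\<Sum>l<n. K (vs ! l) i * K (vs ! l) j / (\<rho> * m)) = (\<Sum>l\<in>V. K i l * K l j) / (\<rho> * m)"
      using sum_nth_distinct[OF vs(1), of "\<lambda>l. K l i * K l j / (\<rho> * m)"] vs(2)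
      by (simp add: n_def sum_divide_distrib sym[of _ i])
    also have "\<dots> = K i j / m" using idem[OF ij] pos by simp
    finally show ?thesis by (simp add: add_divide_distrib)
  qed
  moreover have "c \<in> carrier_vec (Suc n)" "c \<bullet> c = 1" "\<And>i. x i \<in> carrier_vec (Suc n)"
    "\<And>i. c \<bullet> x i = sqrt (b / m)"
    by (auto simp: c_def x_def scalar_prod_def lessThan_atLeast0[symmetric] lessThan_Suc)
  ultimately show ?thesis using that by blast
qed

text \<open>Bessel's inequality for the vectors \<open>u i \<otimes> v i\<close> and \<open>c \<otimes> h\<close>.\<close>

lemma bessel_tensor:
  fixes u v :: "'a \<Rightarrow> real vec"
  assumes fin: "finite I"
    and c: "c \<in> carrier_vec k" "c \<bullet> c = 1" and h: "h \<in> carrier_vec l" "h \<bullet> h = 1"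
    and u: "\<And>i. i \<in> I \<Longrightarrow> u i \<in> carrier_vec k" and v: "\<And>i. i \<in> I \<Longrightarrow> v i \<in> carrier_vec l"
    and orth: "\<And>i j. i \<in> I \<Longrightarrow> j \<in> I \<Longrightarrow> (u i \<bullet> u j) * (v i \<bullet> v j) = of_bool (i = j)"
  shows "(\<Sum>i\<in>I. (c \<bullet> u i)\<^sup>2 * (h \<bullet> v i)\<^sup>2) \<le> 1"
proof -
  \<comment> \<open>\<open>w\<close> is the orthogonal projection of \<open>c \<otimes> h\<close> to
    the span of the orthonormal family, with coefficients \<open>z i\<close>. Tensors are handled
    through their coordinates, which carry two indices.\<close>
  define z where "z i = (c \<bullet> u i) * (h \<bullet> v i)" for i
  define w where "w a b = (\<Sum>i\<in>I. z i * (u i $ a * v i $ b))" for a b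
  have tensor: "(\<Sum>a<k. \<Sum>b<l. (p $ a * q $ b) * (p' $ a * q' $ b)) = (p \<bullet> p') * (q \<bullet> q')"
    if "p' \<in> carrier_vec k" "q' \<in> carrier_vec l" for p q p' q' :: "real vec"
    using that by (simp add: scalar_prod_def lessThan_atLeast0[symmetric] sum_product ac_simps)
  have lin: "(\<Sum>a<k. \<Sum>b<l. f a b * w a b) = (\<Sum>i\<in>I. z i * (\<Sum>a<k. \<Sum>b<l. f a b * (u i $ a * v i $ b)))"
    for f
  proof -
    have "(\<Sum>a<k. \<Sum>b<l. f a b * w a b)
        = (\<Sum>a<k. \<Sum>b<l. \<Sum>i\<in>I. z i * (f a b * (u i $ a * v i $ b)))"
      by (simp add: w_def sum_distrib_left ac_simps)
    also have "\<dots> = (\<Sum>a<k. \<Sum>i\<in>I. \<Sum>b<l. z i * (f a b * (u i $ a * v i $ b)))"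
      by (intro sum.cong refl sum.swap)
    also have "\<dots> = (\<Sum>i\<in>I. \<Sum>a<k. \<Sum>b<l. z i * (f a b * (u i $ a * v i $ b)))"
      by (rule sum.swap)
    finally show ?thesis by (simp add: sum_distrib_left)
  qed
  have cw: "(\<Sum>a<k. \<Sum>b<l. (c $ a * h $ b) * w a b) = (\<Sum>i\<in>I. (z i)\<^sup>2)"
    unfolding lin using u v by (simp add: tensor z_def power2_eq_square)
  have uw: "(\<Sum>a<k. \<Sum>b<l. (u i $ a * v i $ b) * w a b) = z i" if "i \<in> I" for i
    unfolding lin using u v orth that fin by (simp add: tensor if_distrib[of "(*) _"] cong: if_cong)
  have ww: "(\<Sum>a<k. \<Sum>b<l. w a b * w a b) = (\<Sum>i\<in>I. (z i)\<^sup>2)"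
    unfolding lin using uw by (simp add: power2_eq_square mult.commute[of "w _ _"])
  have "0 \<le> (\<Sum>a<k. \<Sum>b<l. (c $ a * h $ b - w a b)\<^sup>2)"
    by (intro sum_nonneg) auto
  also have "\<dots> = (\<Sum>a<k. \<Sum>b<l. (c $ a * h $ b) * (c $ a * h $ b))
      - 2 * (\<Sum>a<k. \<Sum>b<l. (c $ a * h $ b) * w a b) + (\<Sum>a<k. \<Sum>b<l. w a b * w a b)"
    unfolding power2_diff
    by (simp add: sum.distrib sum_subtractf sum_distrib_left power2_eq_square ac_simps)
  also have "\<dots> = 1 - (\<Sum>i\<in>I. (z i)\<^sup>2)"
    using tensor[OF c(1) h(1), of c h] by (simp add: cw ww c h)
  finally show ?thesis by (simp add: z_def power_mult_distrib)
qed

text \<open>The given representation has the same value \<open>\<theta>\<close> at each vertex. For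
  any other one the assumed bound on the sum says that \<open>(c \<bullet> u i)\<^sup>2\<close> is
  at most \<open>1 / \<theta>\<close> on average, hence at some vertex.\<close>

lemma lovasz_theta_eqI:
  assumes fin: "finite (verts G)" and ne: "verts G \<noteq> {}" and \<theta>: "\<theta> > 0"
    and rep: "c \<in> carrier_vec k" "c \<bullet> c = 1" "orthonormal_representation G k u"
      "\<And>i. i \<in> verts G \<Longrightarrow> (c \<bullet> u i)\<^sup>2 = 1 / \<theta>"
    and lower: "\<And>k c u. c \<in> carrier_vec k \<Longrightarrow> c \<bullet> c = 1 \<Longrightarrow> orthonormal_representation G k u \<Longrightarrow>
      (\<Sum>i\<in>verts G. (c \<bullet> u i)\<^sup>2) \<le> card (verts G) / \<theta>"
  shows "lovasz_theta G = ennreal \<theta>"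
proof -
  have val: "1 / ennreal (1 / \<theta>) = ennreal \<theta>"
    using \<theta> divide_ennreal[of 1 "1 / \<theta>"] by simp
  show ?thesis unfolding lovasz_theta_def
  proof (rule antisym)
    have "(SUP i\<in>verts G. 1 / ennreal ((c \<bullet> u i)\<^sup>2)) = ennreal \<theta>"
      using rep(4) ne val by simp
    then show "Inf {SUP i\<in>verts G. 1 / ennreal ((c \<bullet> u i)\<^sup>2) |k c u.
        c \<in> carrier_vec k \<and> c \<bullet> c = 1 \<and> orthonormal_representation G k u} \<le> ennreal \<theta>"
      using rep by (intro Inf_lower) (auto intro!: exI[of _ k] exI[of _ c] exI[of _ u])
  next
    show "ennreal \<theta> \<le> Inf {SUP i\<in>verts G. 1 / ennreal ((c \<bullet> u i)\<^sup>2) |k c u.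
        c \<in> carrier_vec k \<and> c \<bullet> c = 1 \<and> orthonormal_representation G k u}"
    proof (rule Inf_greatest, clarify)
      fix k and c :: "real vec" and u
      assume *: "c \<in> carrier_vec k" "c \<bullet> c = 1" "orthonormal_representation G k u"
      have "\<exists>i\<in>verts G. (c \<bullet> u i)\<^sup>2 \<le> 1 / \<theta>"
      proof (rule ccontr)
        assume "\<not> (\<exists>i\<in>verts G. (c \<bullet> u i)\<^sup>2 \<le> 1 / \<theta>)"
        then have "(\<Sum>i\<in>verts G. 1 / \<theta>) < (\<Sum>i\<in>verts G. (c \<bullet> u i)\<^sup>2)"
          using fin ne by (intro sum_strict_mono) auto
        then show False using lower[OF *] by simp
      qed
      then obtain i where i: "i \<in> verts G" "(c \<bullet> u i)\<^sup>2 \<le> 1 / \<theta>" by auto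
      \<comment> \<open>If the inner product is zero, the quotient is infinite and the bound is
        trivial; otherwise it is a quotient of reals.\<close>
      have "ennreal \<theta> \<le> 1 / ennreal ((c \<bullet> u i)\<^sup>2)"
      proof (cases "c \<bullet> u i = 0")
        case False
        then have "1 / ennreal ((c \<bullet> u i)\<^sup>2) = ennreal (1 / (c \<bullet> u i)\<^sup>2)"
          using divide_ennreal[of 1 "(c \<bullet> u i)\<^sup>2"] by simp
        then show ?thesis using False i(2) \<theta> by (simp add: field_simps ennreal_leI)
      qed simp
      also have "\<dots> \<le> (SUP i\<in>verts G. 1 / ennreal ((c \<bullet> u i)\<^sup>2))"
        using i(1) by (rule SUP_upper)
      finally show "ennreal \<theta> \<le> (SUP i\<in>verts G. 1 / ennreal ((c \<bullet> u i)\<^sup>2))" .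
    qed
  qed
qed

section \<open>The restricted eigenvalues of a strongly regular graph\<close>

text \<open>These are the roots of \<open>x^2 - (lam - mu) x - (d - mu)\<close>. Their product is at
  most 0 because \<open>mu \<le> d\<close>; that the smaller root is strictly negative also uses
  \<open>lam < d\<close>.\<close>

lemma strongly_regular_eigenvalues:
  assumes srg: "strongly_regular G n d lam mu"
  obtains r s :: real where "r + s = real lam - mu" "r * s = real mu - d" "0 \<le> r" "s < 0"
proof -
  interpret graph G using srg by (simp add: strongly_regular_def)
  from srg obtain u v where uv: "u \<in> verts G" "v \<in> verts G" "u \<noteq> v" "\<not> u \<rightarrow>\<^bsub>G\<^esub> v"
    by (auto simp: strongly_regular_def)
  have "mu \<le> d"
    using card_mono[OF finite_neighbours, of "neighbours G u \<inter> neighbours G v" u] uv srg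
    by (simp add: strongly_regular_def)
  from srg obtain a where "a \<in> arcs G" by (auto simp: strongly_regular_def)
  then obtain x y where xy: "x \<rightarrow>\<^bsub>G\<^esub> y" using in_arcs_imp_in_arcs_ends by blast
  then have "neighbours G x \<inter> neighbours G y \<subset> neighbours G x"
    using dominates_irrefl[of y] by (auto simp: neighbours_def)
  from psubset_card_mono[OF finite_neighbours this] have "lam < d"
    using xy dominates_verts[OF xy] srg by (simp add: strongly_regular_def)
  define \<alpha> \<beta> where "\<alpha> = real lam - mu" and "\<beta> = real d - mu"
  define q where "q = sqrt (\<alpha>\<^sup>2 + 4 * \<beta>)"
  have \<beta>: "\<beta> \<ge> 0" using \<open>mu \<le> d\<close> by (simp add: \<beta>_def)
  then have q: "q\<^sup>2 = \<alpha>\<^sup>2 + 4 * \<beta>" "0 \<le> q" by (simp_all add: q_def)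
  have "- \<alpha> \<le> q" unfolding q_def using \<beta> by (intro real_le_rsqrt) simp
  \<comment> \<open>If \<open>\<alpha>\<close> is nonnegative, then \<open>mu \<le> lam < d\<close>,
    so the discriminant exceeds the square of \<open>\<alpha>\<close>.\<close>
  moreover have "\<alpha> < q"
  proof (cases "\<alpha> < 0")
    case False
    then have "\<beta> > 0" using \<open>lam < d\<close> \<open>mu \<le> d\<close> by (simp add: \<alpha>_def \<beta>_def)
    then show ?thesis unfolding q_def by (intro real_less_rsqrt) simp
  qed (use q in simp)
  moreover have "(\<alpha> + q) / 2 * ((\<alpha> - q) / 2) = - \<beta>"
    using q(1) by (simp add: field_simps power2_eq_square)
  ultimately show ?thesis
    by (intro that[of "(\<alpha> + q) / 2" "(\<alpha> - q) / 2"]) (auto simp: \<alpha>_def \<beta>_def field_simps)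
qed

text \<open>The all-ones vector is an eigenvector of \<open>A\<close> for \<open>d\<close>. Applying
  the defect equation to it, that is, computing a row sum of \<open>A^2\<close> in two ways,
  evaluates the polynomial with roots \<open>r\<close> and \<open>s\<close> at
  \<open>d\<close>.\<close>

lemma strongly_regular_card_eq:
  assumes srg: "strongly_regular G n d lam mu"
    and rs: "r + s = real lam - mu" "r * s = real mu - d"
  shows "(d - r) * (d - s) = mu * n"
proof -
  interpret graph G using srg by (simp add: strongly_regular_def)
  note [simp] = sum_adj_eq_card
  have V: "card (verts G) = n" "0 < n"
    and deg: "\<And>v. v \<in> verts G \<Longrightarrow> card (neighbours G v) = d"
    using srg strongly_regular_iff_srg_defect[of n d lam mu] by (auto simp: strongly_regular_def)
  then obtain u where u: "u \<in> verts G" by fastforce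
  have "(\<Sum>v\<in>verts G. codeg G u v) = (\<Sum>w\<in>verts G. \<Sum>v\<in>verts G. adj G u w * adj G w v)"
    unfolding codeg_def by (rule sum.swap)
  also have "\<dots> = d * real d"
    using u deg by (simp flip: sum_distrib_left sum_distrib_right)
  finally have *: "(\<Sum>v\<in>verts G. codeg G u v) = d * real d" .
  have "codeg G u v = (real lam - mu) * adj G u v + (if u = v then real d - mu else 0) + mu"
    if "v \<in> verts G" for v
    using strongly_regular_srg_defect_eq_0[OF srg u that] by (auto simp: srg_defect_def)
  then have "(\<Sum>v\<in>verts G. codeg G u v) = (\<Sum>v\<in>verts G. (real lam - mu) * adj G u v
      + (if u = v then real d - mu else 0) + mu)"
    by (intro sum.cong) auto
  also have "\<dots> = (real lam - mu) * d + (real d - mu) + mu * n"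
    using u V deg by (simp add: sum.distrib flip: sum_distrib_left)
  finally have "d * real d = (real lam - mu) * d + (real d - mu) + mu * n" using * by simp
  moreover have "(d - r) * (d - s) = d * real d - d * (r + s) + r * s" by (simp add: algebra_simps)
  ultimately show ?thesis unfolding rs by (simp add: algebra_simps)
qed

text \<open>\<open>K\<close> is \<open>A - t I\<close> with its part along the all-ones vector
  removed. It kills this vector, and on the orthogonal complement \<open>A\<close> has no
  eigenvalues besides \<open>t\<close> and \<open>t'\<close>, so those of \<open>K\<close> are among
  0 and \<open>t' - t\<close>. The proof verifies the resulting equation entrywise.\<close>

lemma strongly_regular_shifted_adj_square:
  assumes srg: "strongly_regular G n d lam mu"
    and tt: "t + t' = real lam - mu" "t * t' = real mu - d"
    and uv: "u \<in> verts G" "v \<in> verts G"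
  defines "K \<equiv> \<lambda>u v. adj G u v - t * of_bool (u = v) - (d - t) / n"
  shows "(\<Sum>w\<in>verts G. K u w * K w v) = (t' - t) * K u v"
proof -
  interpret graph G using srg by (simp add: strongly_regular_def)
  have V: "card (verts G) = n" "0 < n"
    and deg: "\<And>v. v \<in> verts G \<Longrightarrow> (\<Sum>w\<in>verts G. adj G v w) = d"
    using srg strongly_regular_iff_srg_defect[of n d lam mu]
    by (auto simp: strongly_regular_def sum_adj_eq_card)
  have deg': "(\<Sum>w\<in>verts G. adj G w v) = d" using deg[OF uv(2)] by (simp add: adj_commute[of _ v])
  define e where "e = (d - t) / n"
  have en: "e * n = d - t" using V by (simp add: e_def)
  \<comment> \<open>This turns the constant term \<open>mu\<close> of \<open>A^2\<close> into a
    multiple of \<open>e\<close>, as required for comparing the coefficients of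
    \<open>J\<close>.\<close>
  have mun: "mu = e * (d - t')"
    using strongly_regular_card_eq[OF srg tt] V by (simp add: e_def field_simps)
  have "K u w * K w v = adj G u w * adj G w v - e * adj G u w - e * adj G w v + e\<^sup>2
      + (if u = w then t\<^sup>2 * of_bool (u = v) - t * adj G u v + t * e else 0)
      + (if v = w then t * e - t * adj G u v else 0)" for w
    unfolding K_def e_def[symmetric] by (auto simp: power2_eq_square algebra_simps)
  then have "(\<Sum>w\<in>verts G. K u w * K w v) = codeg G u v - e * d - e * d + n * e\<^sup>2
      + (t\<^sup>2 * of_bool (u = v) - t * adj G u v + t * e) + (t * e - t * adj G u v)"
    using uv V deg[OF uv(1)] deg'
    by (simp add: sum.distrib sum_subtractf codeg_def flip: sum_distrib_left)
  also have "codeg G u v = (t + t') * adj G u v - t * t' * of_bool (u = v) + e * (d - t')"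
    using strongly_regular_srg_defect_eq_0[OF srg uv]
    unfolding tt mun[symmetric] by (simp add: srg_defect_def algebra_simps)
  also have "n * e\<^sup>2 = e * (d - t)" using en by (simp add: power2_eq_square mult.commute mult.left_commute)
  finally show ?thesis
    unfolding K_def e_def[symmetric] by (simp add: power2_eq_square algebra_simps)
qed

section \<open>The theta-function of a strongly regular graph\<close>

lemma lovasz_theta_strongly_regular:
  assumes srg: "strongly_regular G n d lam mu"
    and rs: "r + s = real lam - mu" "r * s = real mu - d" "0 \<le> r" "s < 0"
  shows "lovasz_theta G = ennreal (n * (- s) / (d - s))"
proof -
  interpret graph G using srg by (simp add: strongly_regular_def)
  have V: "card (verts G) = n" "0 < n" "d < n"
    using srg strongly_regular_iff_srg_defect[of n d lam mu] by auto
  have ds: "d - s > 0" using rs by simp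
  have mun: "(d - r) * (d - s) = mu * n" by (rule strongly_regular_card_eq[OF srg rs(1,2)])
  \<comment> \<open>Adding \<open>(d - s) / n\<close> to \<open>K s\<close> yields
    \<open>A - s I\<close>, and adding \<open>(n - d + r) / n\<close> to \<open>- K r\<close> yields
    \<open>J - A + r I\<close>. These constants are the shifts \<open>b\<close> in the two uses of
    \<open>gram_representation\<close>.\<close>
  define K where "K t u v = adj G u v - t * of_bool (u = v) - (d - t) / n" for t :: real and u v
  have Ksym: "K t u v = K t v u" for t :: real and u v
    by (simp add: K_def adj_commute[of u v] eq_commute[of u v])
  have K_square: "(\<Sum>w\<in>verts G. K t u w * K t w v) = (t' - t) * K t u v"
    if "t + t' = real lam - mu" "t * t' = real mu - d" "u \<in> verts G" "v \<in> verts G" for t t' u v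
    using strongly_regular_shifted_adj_square[OF srg that] by (simp add: K_def)
  have KK: "(\<Sum>w\<in>verts G. K s u w * K s w v) = (r - s) * K s u v"
    if "u \<in> verts G" "v \<in> verts G" for u v
    using K_square[OF _ _ that, of s r] rs by (simp add: add.commute mult.commute)
  have LL: "(\<Sum>w\<in>verts G. (- K r u w) * (- K r w v)) = (r - s) * (- K r u v)"
    if "u \<in> verts G" "v \<in> verts G" for u v
    using K_square[OF _ _ that, of r s] rs by (simp add: left_diff_distrib)
  define \<theta> where "\<theta> = n * (- s) / (d - s)"
  have \<theta>: "\<theta> > 0" unfolding \<theta>_def using V ds rs by (intro divide_pos_pos mult_pos_pos) auto
  have pos: "r - s > 0" "(d - s) / n \<ge> 0" "- s > 0" "(real n - d + r) / n > 0" "1 + r > 0"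
    using V ds rs by auto
  obtain k c x where x: "c \<in> carrier_vec k" "c \<bullet> c = 1"
    "\<And>i. x i \<in> carrier_vec k" "\<And>i. c \<bullet> x i = sqrt ((d - s) / n / (- s))"
    "\<And>i j. i \<in> verts G \<Longrightarrow> j \<in> verts G \<Longrightarrow> x i \<bullet> x j = (K s i j + (d - s) / n) / (- s)"
    by (rule gram_representation[OF finite_verts Ksym KK pos(1-3)]) blast+
  obtain l h y where y: "h \<in> carrier_vec l" "h \<bullet> h = 1"
    "\<And>i. y i \<in> carrier_vec l" "\<And>i. h \<bullet> y i = sqrt ((real n - d + r) / n / (1 + r))"
    "\<And>i j. i \<in> verts G \<Longrightarrow> j \<in> verts G \<Longrightarrow>
      y i \<bullet> y j = (- K r i j + (real n - d + r) / n) / (1 + r)"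
    by (rule gram_representation[of "verts G" "\<lambda>i j. - K r i j" "r - s" "(real n - d + r) / n" "1 + r"])
      (use finite_verts Ksym LL pos in \<open>blast intro: less_imp_le | simp\<close>)+
  show ?thesis unfolding \<theta>_def[symmetric]
  proof (rule lovasz_theta_eqI[OF finite_verts _ \<theta> x(1,2)])
    show "verts G \<noteq> {}" using V by auto
    show "orthonormal_representation G k x"
      unfolding orthonormal_representation_def using x(3) rs
      by (auto simp: x(5) K_def adj_self) (simp add: adj_def)
    show "(c \<bullet> x i)\<^sup>2 = 1 / \<theta>" for i
    proof -
      have "0 \<le> (d - s) / n / (- s)" using ds rs V by (intro divide_nonneg_pos) auto
      then show ?thesis
        unfolding x(4) \<theta>_def by (subst real_sqrt_pow2) (auto simp: divide_simps)
    qed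
  next
    fix k' and c' :: "real vec" and u
    assume c': "c' \<in> carrier_vec k'" "c' \<bullet> c' = 1" and u: "orthonormal_representation G k' u"
    have "(\<Sum>i\<in>verts G. (c' \<bullet> u i)\<^sup>2 * (h \<bullet> y i)\<^sup>2) \<le> 1"
    proof (rule bessel_tensor[OF finite_verts c' y(1,2)])
      show "u i \<in> carrier_vec k'" if "i \<in> verts G" for i
        using u that by (simp add: orthonormal_representation_def)
      \<comment> \<open>For distinct vertices the first factor vanishes on nonadjacent pairs and the
        second on adjacent ones.\<close>
      show "u i \<bullet> u j * (y i \<bullet> y j) = of_bool (i = j)" if ij: "i \<in> verts G" "j \<in> verts G" for i j
      proof -
        have "- K r i j + (real n - d + r) / n = 1 - adj G i j + r * of_bool (i = j)"
          using V by (simp add: K_def field_simps)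
        then have "y i \<bullet> y j = (1 - adj G i j + r * of_bool (i = j)) / (1 + r)"
          using y(5)[OF ij] by simp
        then show ?thesis
          using u ij rs(3) adj_self[of j]
            by (auto simp: orthonormal_representation_def adj_def split: if_splits)
      qed
    qed (rule y(3))
    moreover have "(sqrt ((real n - d + r) / n / (1 + r)))\<^sup>2 = (real n - d + r) / n / (1 + r)"
      using V rs by (intro real_sqrt_pow2 divide_nonneg_nonneg) auto
    ultimately have "(\<Sum>i\<in>verts G. (c' \<bullet> u i)\<^sup>2) * ((real n - d + r) / n / (1 + r)) \<le> 1"
      unfolding y(4) by (simp only: sum_distrib_right)
    then have "(\<Sum>i\<in>verts G. (c' \<bullet> u i)\<^sup>2) \<le> 1 / ((real n - d + r) / n / (1 + r))"
      by (subst pos_le_divide_eq[OF divide_pos_pos[OF pos(4,5)]])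
    also have "\<dots> = n * (1 + r) / (real n - d + r)" by simp
    \<comment> \<open>The upper and the lower bound meet here, thanks to \<open>mun\<close> and
      \<open>r * s = mu - d\<close>.\<close>
    also have "\<dots> = (d - s) / (- s)"
    proof -
      have "n * (1 + r) * (- s) = (d - s) * (real n - d + r)"
      proof -
        have "n * (1 + r) * (- s) = - (n * s) - n * (r * s)" by (simp add: algebra_simps)
        moreover have "(d - s) * (real n - d + r) = (d - s) * n - (d - r) * (d - s)"
          by (simp add: algebra_simps)
        ultimately show ?thesis unfolding mun rs(2) by (simp add: algebra_simps)
      qed
      moreover have "real n - d + r > 0" using V rs by simp
      ultimately show ?thesis using rs(4) by (subst frac_eq_eq) auto
    qed
    also have "\<dots> = card (verts G) / \<theta>" using V ds rs by (simp add: \<theta>_def)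
    finally show "(\<Sum>i\<in>verts G. (c' \<bullet> u i)\<^sup>2) \<le> card (verts G) / \<theta>" .
  qed
qed

section \<open>Counting edges and triangles\<close>

lemma (in graph) dominates_sym: "u \<rightarrow>\<^bsub>G\<^esub> v \<Longrightarrow> v \<rightarrow>\<^bsub>G\<^esub> u"
  using sym_arcs by (auto simp: symmetric_def dest: symD)

lemma (in graph) arcs_ends_eq_Sigma: "arcs_ends G = Sigma (verts G) (neighbours G)"
  by (auto simp: neighbours_def adj_in_verts)

lemma (in graph) finite_arcs_ends: "finite (arcs_ends G)"
  by (simp add: arcs_ends_eq_Sigma finite_neighbours)

lemma (in graph) card_arcs_ends: "card (arcs_ends G) = (\<Sum>u\<in>verts G. card (neighbours G u))"
  by (simp add: arcs_ends_eq_Sigma finite_neighbours)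

text \<open>Double counting with fibres of constant size: an edge has 2 orderings, a triangle
  6.\<close>

lemma card_eq_mult_card_image:
  assumes "finite S" "\<And>y. y \<in> f ` S \<Longrightarrow> card {x \<in> S. f x = y} = k"
  shows "card S = k * card (f ` S)"
  using sum.image_gen[OF assms(1), of "\<lambda>_. 1 :: nat" f] assms(2) by simp

lemma (in graph) handshake: "2 * num_edges G = (\<Sum>u\<in>verts G. card (neighbours G u))"
proof -
  let ?P = "arcs_ends G" and ?f = "\<lambda>(u, v). {u, v}"
  have "card ?P = 2 * card (?f ` ?P)"
  proof (rule card_eq_mult_card_image[OF finite_arcs_ends])
    fix e assume "e \<in> ?f ` ?P"
    then obtain u v where uv: "u \<rightarrow>\<^bsub>G\<^esub> v" "e = {u, v}" by force
    have "{p \<in> ?P. ?f p = e} = {(u, v), (v, u)}"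
    proof (intro subset_antisym subsetI)
      fix p assume "p \<in> {p \<in> ?P. ?f p = e}"
      moreover obtain x y where p: "p = (x, y)" by (cases p)
      ultimately have "{x, y} = {u, v}" using uv(2) by simp
      then show "p \<in> {(u, v), (v, u)}" unfolding p doubleton_eq_iff by blast
    next
      fix p assume "p \<in> {(u, v), (v, u)}"
      then show "p \<in> {p \<in> ?P. ?f p = e}"
        using uv dominates_sym[OF uv(1)] by (elim insertE) (simp_all add: insert_commute)
    qed
    moreover have "u \<noteq> v" using uv dominates_irrefl by auto
    ultimately show "card {p \<in> ?P. ?f p = e} = 2" by simp
  qed
  moreover have "?f ` ?P = {{u, v} | u v. u \<rightarrow>\<^bsub>G\<^esub> v}" by force
  ultimately show ?thesis by (simp add: num_edges_def card_arcs_ends)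
qed

text \<open>\<open>Q\<close> is the set of ordered triangles. Over a fixed pair
  \<open>(u, v)\<close> the third vertex ranges over the common neighbours, whereas forgetting the
  order is six-to-one.\<close>

lemma (in graph) sum_codegrees_eq_triangles:
  "6 * num_triangles G =
    (\<Sum>(u, v)\<in>arcs_ends G. card (neighbours G u \<inter> neighbours G v))"
proof -
  let ?P = "arcs_ends G" and ?f = "\<lambda>((u, v), w). {u, v, w}"
  define Q where "Q = Sigma ?P (\<lambda>(u, v). neighbours G u \<inter> neighbours G v)"
  have Q: "((u, v), w) \<in> Q \<longleftrightarrow> u \<rightarrow>\<^bsub>G\<^esub> v \<and> u \<rightarrow>\<^bsub>G\<^esub> w \<and> v \<rightarrow>\<^bsub>G\<^esub> w" for u v w
    by (auto simp: Q_def neighbours_def)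
  have finQ: "finite Q"
    unfolding Q_def using finite_arcs_ends by (intro finite_SigmaI) (auto simp: finite_neighbours)
  have "card Q = 6 * card (?f ` Q)"
  proof (rule card_eq_mult_card_image[OF finQ])
    fix T assume "T \<in> ?f ` Q"
    then obtain a b c where abc: "((a, b), c) \<in> Q" "T = {a, b, c}" by force
    then have e: "a \<rightarrow>\<^bsub>G\<^esub> b" "a \<rightarrow>\<^bsub>G\<^esub> c" "b \<rightarrow>\<^bsub>G\<^esub> c" "b \<rightarrow>\<^bsub>G\<^esub> a" "c \<rightarrow>\<^bsub>G\<^esub> a" "c \<rightarrow>\<^bsub>G\<^esub> b"
      by (auto simp: Q dominates_sym)
    then have ne: "a \<noteq> b" "a \<noteq> c" "b \<noteq> c" using dominates_irrefl by auto
    let ?S = "{((a, b), c), ((a, c), b), ((b, a), c), ((b, c), a), ((c, a), b), ((c, b), a)}"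
    have "{q \<in> Q. ?f q = T} = ?S"
    proof (intro subset_antisym subsetI)
      fix q assume "q \<in> {q \<in> Q. ?f q = T}"
      moreover obtain x y z where q: "q = ((x, y), z)" by (metis surj_pair)
      ultimately have xyz: "((x, y), z) \<in> Q" "{x, y, z} = {a, b, c}" using abc(2) by simp_all
      then have "x \<noteq> y" "x \<noteq> z" "y \<noteq> z" using dominates_irrefl by (auto simp: Q)
      moreover have "x \<in> {a, b, c}" "y \<in> {a, b, c}" "z \<in> {a, b, c}" using xyz(2) by blast+
      ultimately show "q \<in> ?S" unfolding q by blast
    next
      fix q assume "q \<in> ?S"
      then show "q \<in> {q \<in> Q. ?f q = T}"
        using e abc(2) by (elim insertE) (simp_all add: Q insert_commute)
    qed
    then show "card {q \<in> Q. ?f q = T} = 6" using ne by simp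
  qed
  moreover have "?f ` Q = {T. T \<subseteq> verts G \<and> card T = 3 \<and> (\<forall>u\<in>T. \<forall>v\<in>T. u \<noteq> v \<longrightarrow> u \<rightarrow>\<^bsub>G\<^esub> v)}"
    (is "_ = ?R")
  proof (intro subset_antisym subsetI)
    fix T assume "T \<in> ?f ` Q"
    then obtain a b c where abc: "((a, b), c) \<in> Q" "T = {a, b, c}" by force
    then have e: "a \<rightarrow>\<^bsub>G\<^esub> b" "a \<rightarrow>\<^bsub>G\<^esub> c" "b \<rightarrow>\<^bsub>G\<^esub> c" "b \<rightarrow>\<^bsub>G\<^esub> a" "c \<rightarrow>\<^bsub>G\<^esub> a" "c \<rightarrow>\<^bsub>G\<^esub> b"
      by (auto simp: Q dominates_sym)
    then have "a \<noteq> b" "a \<noteq> c" "b \<noteq> c" using dominates_irrefl by auto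
    then show "T \<in> ?R" using e abc(2) by (auto simp: adj_in_verts)
  next
    fix T assume T: "T \<in> ?R"
    then obtain a b c where abc: "T = {a, b, c}" "a \<noteq> b" "b \<noteq> c" "a \<noteq> c"
      by (auto simp: card_3_iff)
    then have "((a, b), c) \<in> Q" using T by (auto simp: Q)
    then show "T \<in> ?f ` Q" using abc(1) by (intro image_eqI[of _ _ "((a, b), c)"]) simp_all
  qed
  moreover have "card Q = (\<Sum>(u, v)\<in>?P. card (neighbours G u \<inter> neighbours G v))"
    unfolding Q_def using finite_arcs_ends
    by (subst card_SigmaI) (auto simp: finite_neighbours intro!: sum.cong)
  ultimately show ?thesis by (simp add: num_triangles_def)
qed

lemma strongly_regular_num_edges:
  assumes "strongly_regular G n d lam mu"
  shows "2 * num_edges G = n * d"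
  using assms graph.handshake[of G] by (simp add: strongly_regular_def)

lemma strongly_regular_num_triangles:
  assumes srg: "strongly_regular G n d lam mu"
  shows "6 * num_triangles G = n * d * lam"
proof -
  interpret graph G using srg by (simp add: strongly_regular_def)
  have "6 * num_triangles G = (\<Sum>(u, v)\<in>arcs_ends G. lam)"
    unfolding sum_codegrees_eq_triangles using srg
    by (intro sum.cong) (auto simp: strongly_regular_def adj_in_verts)
  also have "\<dots> = card (arcs_ends G) * lam" by (simp add: case_prod_unfold)
  finally show ?thesis using srg by (simp add: card_arcs_ends strongly_regular_def)
qed

section \<open>Connectedness and the diameter\<close>

text \<open>If \<open>mu\<close> were 0, a walk of length two from \<open>u\<close> could end only
  at \<open>u\<close> or at a neighbour of \<open>u\<close>. By induction nothing else would be
  reachable from \<open>u\<close>, although some vertex is not adjacent to it.\<close>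

lemma strongly_regular_connected_imp_mu_pos:
  assumes srg: "strongly_regular G n d lam mu" and conn: "Digraph_Component.connected G"
  shows "0 < mu"
proof (rule ccontr)
  assume "\<not> 0 < mu"
  then have mu: "mu = 0" by simp
  interpret graph G using srg by (simp add: strongly_regular_def)
  from srg obtain u v where uv: "u \<in> verts G" "v \<in> verts G" "u \<noteq> v" "\<not> u \<rightarrow>\<^bsub>G\<^esub> v"
    by (auto simp: strongly_regular_def)
  have step: "u = y \<or> u \<rightarrow>\<^bsub>G\<^esub> y" if "u \<rightarrow>\<^bsub>G\<^esub> x" "x \<rightarrow>\<^bsub>G\<^esub> y" for x y
  proof (rule ccontr)
    assume "\<not> (u = y \<or> u \<rightarrow>\<^bsub>G\<^esub> y)"
    then have "card (neighbours G u \<inter> neighbours G y) = 0"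
      using srg mu uv(1) dominates_verts(2)[OF that(2)] by (simp add: strongly_regular_def)
    moreover have "x \<in> neighbours G u \<inter> neighbours G y"
      using that by (auto simp: neighbours_def dominates_sym)
    ultimately show False using finite_neighbours by auto
  qed
  have "strongly_connected G"
    using symmetric_connected_imp_strongly_connected[OF sym_arcs conn] .
  then have "u \<rightarrow>\<^sup>*\<^bsub>G\<^esub> v" using uv by auto
  then have "(u, v) \<in> (arcs_ends G)\<^sup>*"
    unfolding reachable_def by (rule rtrancl_on_rtranclI)
  then have "u = v \<or> u \<rightarrow>\<^bsub>G\<^esub> v"
    by (induction rule: rtrancl_induct) (auto dest: step)
  then show False using uv by simp
qed

lemma strongly_regular_common_neighbour:
  assumes "strongly_regular G n d lam mu" "0 < mu" "u \<in> verts G" "v \<in> verts G" "u \<noteq> v"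
    "\<not> u \<rightarrow>\<^bsub>G\<^esub> v"
  obtains w where "u \<rightarrow>\<^bsub>G\<^esub> w" "w \<rightarrow>\<^bsub>G\<^esub> v"
proof -
  interpret graph G using assms(1) by (simp add: strongly_regular_def)
  have "card (neighbours G u \<inter> neighbours G v) > 0" using assms by (simp add: strongly_regular_def)
  then obtain w where "w \<in> neighbours G u \<inter> neighbours G v" by (auto simp: card_gt_0_iff)
  then show ?thesis using that by (auto simp: neighbours_def dominates_sym)
qed

lemma (in graph) obtain_arc:
  assumes "u \<rightarrow>\<^bsub>G\<^esub> v"
  obtains a where "a \<in> arcs G" "tail G a = u" "head G a = v"
  using assms by (auto simp: arcs_ends_def arc_to_ends_def)

text \<open>A common neighbour joins any two nonadjacent vertices by a walk of length two, and a
  nonadjacent pair exists, for which no shorter walk is possible.\<close>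

lemma strongly_regular_diameter:
  assumes srg: "strongly_regular G n d lam mu" and mu: "0 < mu"
  shows "diameter G = 2"
proof -
  interpret graph G using srg by (simp add: strongly_regular_def)
  have cost: "awalk_cost (\<lambda>_. 1) p = length p" for p
    by (simp add: awalk_cost_def sum_list_triv)
  have le: "\<mu> (\<lambda>_. 1) u v \<le> 2" if uv: "u \<in> verts G" "v \<in> verts G" for u v
  proof -
    have "\<exists>p. awalk u p v \<and> length p \<le> 2"
    proof (cases "u = v \<or> u \<rightarrow>\<^bsub>G\<^esub> v")
      case True
      then show ?thesis
      proof
        assume "u \<rightarrow>\<^bsub>G\<^esub> v"
        then obtain a where "a \<in> arcs G" "tail G a = u" "head G a = v" by (rule obtain_arc)
        then show ?thesis using uv by (intro exI[of _ "[a]"]) (simp add: awalk_def)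
      qed (use uv in \<open>auto simp: awalk_def intro!: exI[of _ "[]"]\<close>)
    next
      case False
      then obtain w where w: "u \<rightarrow>\<^bsub>G\<^esub> w" "w \<rightarrow>\<^bsub>G\<^esub> v"
        using strongly_regular_common_neighbour[OF srg mu uv] by auto
      obtain a where "a \<in> arcs G" "tail G a = u" "head G a = w" using w(1) by (rule obtain_arc)
      moreover obtain b where "b \<in> arcs G" "tail G b = w" "head G b = v" using w(2) by (rule obtain_arc)
      ultimately show ?thesis using uv by (intro exI[of _ "[a, b]"]) (simp add: awalk_def)
    qed
    then obtain p where p: "awalk u p v" "length p \<le> 2" by blast
    have "\<mu> (\<lambda>_. 1) u v \<le> ereal (awalk_cost (\<lambda>_. 1) p)"
      using p(1) by (rule min_cost_le_walk_cost)
    also have "\<dots> \<le> 2" using p(2) by (simp add: cost)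
    finally show ?thesis .
  qed
  from srg obtain u v where uv: "u \<in> verts G" "v \<in> verts G" "u \<noteq> v" "\<not> u \<rightarrow>\<^bsub>G\<^esub> v"
    by (auto simp: strongly_regular_def)
  have "2 \<le> \<mu> (\<lambda>_. 1) u v"
    unfolding \<mu>_def
  proof (rule INF_greatest)
    fix p assume "p \<in> {p. awalk u p v}"
    then have p: "awalk u p v" by simp
    have "2 \<le> length p"
    proof (rule ccontr)
      assume "\<not> 2 \<le> length p"
      then consider "p = []" | a where "p = [a]"
        by (cases p rule: remdups_adj.cases) auto
      then show False
        using p uv in_arcs_imp_in_arcs_ends by cases (auto simp: awalk_def)
    qed
    then show "2 \<le> ereal (awalk_cost (\<lambda>_. 1) p)" by (simp add: cost)
  qed
  then have "2 \<le> diameter G"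
    unfolding diameter_def using uv(1,2) by (intro SUP_upper2[OF uv(1)] SUP_upper2[OF uv(2)])
  moreover have "diameter G \<le> 2"
    unfolding diameter_def using le by (intro SUP_least)
  ultimately show ?thesis by (rule antisym[rotated])
qed

section \<open>Short cycles and the girth\<close>

text \<open>Without loops three cyclically adjacent vertices are automatically distinct. For length
  4 distinctness has to be stated, because walking an edge back and forth twice also closes
  up.\<close>

lemma (in graph) ex_cycle_length_3_iff:
  "(\<exists>p. cycle p \<and> length p = 3) \<longleftrightarrow> (\<exists>u v w. u \<rightarrow>\<^bsub>G\<^esub> v \<and> v \<rightarrow>\<^bsub>G\<^esub> w \<and> w \<rightarrow>\<^bsub>G\<^esub> u)"
proof
  assume "\<exists>p. cycle p \<and> length p = 3"
  then obtain a b c where "cycle [a, b, c]" by (auto simp: numeral_eq_Suc length_Suc_conv)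
  then have "a \<in> arcs G" "b \<in> arcs G" "c \<in> arcs G"
    "tail G b = head G a" "tail G c = head G b" "tail G a = head G c"
    by (auto simp: cycle_def awalk_def)
  then show "\<exists>u v w. u \<rightarrow>\<^bsub>G\<^esub> v \<and> v \<rightarrow>\<^bsub>G\<^esub> w \<and> w \<rightarrow>\<^bsub>G\<^esub> u"
    by (metis in_arcs_imp_in_arcs_ends)
next
  assume "\<exists>u v w. u \<rightarrow>\<^bsub>G\<^esub> v \<and> v \<rightarrow>\<^bsub>G\<^esub> w \<and> w \<rightarrow>\<^bsub>G\<^esub> u"
  then obtain u v w where e: "u \<rightarrow>\<^bsub>G\<^esub> v" "v \<rightarrow>\<^bsub>G\<^esub> w" "w \<rightarrow>\<^bsub>G\<^esub> u" by auto
  obtain a where a: "a \<in> arcs G" "tail G a = u" "head G a = v" using e(1) by (rule obtain_arc)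
  obtain b where b: "b \<in> arcs G" "tail G b = v" "head G b = w" using e(2) by (rule obtain_arc)
  obtain c where c: "c \<in> arcs G" "tail G c = w" "head G c = u" using e(3) by (rule obtain_arc)
  have "u \<noteq> v" "v \<noteq> w" "w \<noteq> u" using e dominates_irrefl by auto
  then have "cycle [a, b, c]"
    unfolding cycle_def using a b c e(1) by (intro exI[of _ u]) (auto simp: awalk_def adj_in_verts)
  then show "\<exists>p. cycle p \<and> length p = 3" by force
qed

lemma (in graph) ex_cycle_length_4_iff:
  "(\<exists>p. cycle p \<and> length p = 4) \<longleftrightarrow>
    (\<exists>u v w x. distinct [u, v, w, x] \<and> u \<rightarrow>\<^bsub>G\<^esub> v \<and> v \<rightarrow>\<^bsub>G\<^esub> w \<and> w \<rightarrow>\<^bsub>G\<^esub> x \<and> x \<rightarrow>\<^bsub>G\<^esub> u)"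
  (is "_ \<longleftrightarrow> ?R")
proof
  assume "\<exists>p. cycle p \<and> length p = 4"
  then obtain a b c e where "cycle [a, b, c, e]" by (auto simp: numeral_eq_Suc length_Suc_conv)
  then have "a \<in> arcs G" "b \<in> arcs G" "c \<in> arcs G" "e \<in> arcs G"
    "tail G b = head G a" "tail G c = head G b" "tail G e = head G c" "tail G a = head G e"
    "distinct [head G a, head G b, head G c, head G e]"
    by (auto simp: cycle_def awalk_def)
  then show ?R
    by (metis in_arcs_imp_in_arcs_ends)
next
  assume ?R
  then obtain u v w x
    where dist: "distinct [u, v, w, x]" and e: "u \<rightarrow>\<^bsub>G\<^esub> v" "v \<rightarrow>\<^bsub>G\<^esub> w" "w \<rightarrow>\<^bsub>G\<^esub> x" "x \<rightarrow>\<^bsub>G\<^esub> u"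
    by auto
  obtain a where a: "a \<in> arcs G" "tail G a = u" "head G a = v" using e(1) by (rule obtain_arc)
  obtain b where b: "b \<in> arcs G" "tail G b = v" "head G b = w" using e(2) by (rule obtain_arc)
  obtain c where c: "c \<in> arcs G" "tail G c = w" "head G c = x" using e(3) by (rule obtain_arc)
  obtain f where f: "f \<in> arcs G" "tail G f = x" "head G f = u" using e(4) by (rule obtain_arc)
  have "cycle [a, b, c, f]" unfolding cycle_def using a b c f e(1) dist
    by (intro exI[of _ u]) (auto simp: awalk_def adj_in_verts)
  then show "\<exists>p. cycle p \<and> length p = 4" by force
qed

lemma (in graph) ex_cycle_length_5:
  assumes dist: "distinct [u, v, w, x, y]"
    and e: "u \<rightarrow>\<^bsub>G\<^esub> v" "v \<rightarrow>\<^bsub>G\<^esub> w" "w \<rightarrow>\<^bsub>G\<^esub> x" "x \<rightarrow>\<^bsub>G\<^esub> y" "y \<rightarrow>\<^bsub>G\<^esub> u"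
  shows "\<exists>p. cycle p \<and> length p = 5"
proof -
  obtain a where a: "a \<in> arcs G" "tail G a = u" "head G a = v" using e(1) by (rule obtain_arc)
  obtain b where b: "b \<in> arcs G" "tail G b = v" "head G b = w" using e(2) by (rule obtain_arc)
  obtain c where c: "c \<in> arcs G" "tail G c = w" "head G c = x" using e(3) by (rule obtain_arc)
  obtain f where f: "f \<in> arcs G" "tail G f = x" "head G f = y" using e(4) by (rule obtain_arc)
  obtain g where g: "g \<in> arcs G" "tail G g = y" "head G g = u" using e(5) by (rule obtain_arc)
  have "cycle [a, b, c, f, g]" unfolding cycle_def using a b c f g e(1) dist
    by (intro exI[of _ u]) (auto simp: awalk_def adj_in_verts)
  then show ?thesis by force
qed

lemma girth_eqI:
  assumes "\<exists>p. pre_digraph.cycle G p \<and> length p = k" "3 \<le> k"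
    and "\<And>l. 3 \<le> l \<Longrightarrow> l < k \<Longrightarrow> \<nexists>p. pre_digraph.cycle G p \<and> length p = l"
  shows "girth G = enat k"
proof (rule antisym)
  show "girth G \<le> enat k"
    unfolding girth_def using assms(1,2) by (auto intro!: INF_lower)
  show "enat k \<le> girth G"
    unfolding girth_def using assms(3) by (intro INF_greatest) (auto simp: not_less[symmetric])
qed

text \<open>A common neighbour of adjacent vertices closes a triangle, and two common neighbours of
  a nonadjacent pair close a square. If neither occurs, a pentagon is constructed through a
  nonadjacent pair \<open>u\<close>, \<open>v\<close> and its common neighbour
  \<open>w\<close>.\<close>

lemma strongly_regular_girth:
  assumes srg: "strongly_regular G n d lam mu" and mu: "0 < mu"
  shows "girth G = (if 0 < lam then 3 else if 2 \<le> mu then 4 else 5)"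
proof -
  interpret graph G using srg by (simp add: strongly_regular_def)
  have lam_card: "card (neighbours G x \<inter> neighbours G y) = lam" if "x \<rightarrow>\<^bsub>G\<^esub> y" for x y
    using srg that by (auto simp: strongly_regular_def adj_in_verts)
  have mu_card: "card (neighbours G x \<inter> neighbours G y) = mu"
    if "x \<in> verts G" "y \<in> verts G" "x \<noteq> y" "\<not> x \<rightarrow>\<^bsub>G\<^esub> y" for x y
    using srg that by (auto simp: strongly_regular_def)
  from srg obtain u v where uv: "u \<in> verts G" "v \<in> verts G" "u \<noteq> v" "\<not> u \<rightarrow>\<^bsub>G\<^esub> v"
    by (auto simp: strongly_regular_def)
  obtain w where w: "u \<rightarrow>\<^bsub>G\<^esub> w" "w \<rightarrow>\<^bsub>G\<^esub> v"
    by (rule strongly_regular_common_neighbour[OF srg mu uv])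
  have two: "2 \<le> card (neighbours G x \<inter> neighbours G y)"
    if "x \<rightarrow>\<^bsub>G\<^esub> a" "a \<rightarrow>\<^bsub>G\<^esub> y" "x \<rightarrow>\<^bsub>G\<^esub> b" "b \<rightarrow>\<^bsub>G\<^esub> y" "a \<noteq> b" for x y a b
    using that card_mono[of "neighbours G x \<inter> neighbours G y" "{a, b}"] finite_neighbours
    by (simp add: neighbours_def dominates_sym)
  show ?thesis
  proof (cases "0 < lam")
    case True
    then have "card (neighbours G u \<inter> neighbours G w) > 0" using lam_card[OF w(1)] by simp
    then obtain x where "x \<in> neighbours G u \<inter> neighbours G w" by (auto simp: card_gt_0_iff)
    then have "\<exists>p. cycle p \<and> length p = 3"
      unfolding ex_cycle_length_3_iff using w(1) by (auto simp: neighbours_def intro: dominates_sym)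
    then show ?thesis using True girth_eqI[of G 3] by (simp add: numeral_eq_enat)
  next
    case False
    then have lam: "lam = 0" by simp
    have no_triangle: False if "x \<rightarrow>\<^bsub>G\<^esub> y" "y \<rightarrow>\<^bsub>G\<^esub> z" "z \<rightarrow>\<^bsub>G\<^esub> x" for x y z
    proof -
      have "z \<in> neighbours G x \<inter> neighbours G y" using that by (simp add: neighbours_def dominates_sym)
      then show False using lam_card[OF that(1)] lam finite_neighbours by auto
    qed
    then have no3: "\<nexists>p. cycle p \<and> length p = 3" unfolding ex_cycle_length_3_iff by blast
    show ?thesis
    proof (cases "2 \<le> mu")
      case True
      have "neighbours G u \<inter> neighbours G v \<noteq> {w}"
        using mu_card[OF uv] True by auto
      moreover have "w \<in> neighbours G u \<inter> neighbours G v" using w by (simp add: neighbours_def dominates_sym)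
      ultimately obtain x where "x \<in> neighbours G u \<inter> neighbours G v" "x \<noteq> w" by blast
      then have x: "u \<rightarrow>\<^bsub>G\<^esub> x" "v \<rightarrow>\<^bsub>G\<^esub> x" "x \<noteq> w" by (auto simp: neighbours_def)
      have "distinct [u, w, v, x]" using w x uv dominates_irrefl by auto
      then have "\<exists>p. cycle p \<and> length p = 4"
        unfolding ex_cycle_length_4_iff using w x dominates_sym by blast
      moreover have "\<nexists>p. cycle p \<and> length p = l" if "3 \<le> l" "l < 4" for l
        using that no3 by (cases "l = 3") auto
      ultimately show ?thesis using lam True girth_eqI[of G 4] by (simp add: numeral_eq_enat)
    next
      case False
      then have mu1: "mu = 1" using mu by simp
      \<comment> \<open>Without triangles opposite corners of a square are nonadjacent, yet they
        would have two common neighbours.\<close>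
      have no_square: False
        if "x \<rightarrow>\<^bsub>G\<^esub> a" "a \<rightarrow>\<^bsub>G\<^esub> y" "x \<rightarrow>\<^bsub>G\<^esub> b" "b \<rightarrow>\<^bsub>G\<^esub> y" "a \<noteq> b" "x \<noteq> y" for x y a b
      proof -
        have "\<not> x \<rightarrow>\<^bsub>G\<^esub> y" using no_triangle[OF that(1,2)] dominates_sym by blast
        then have "card (neighbours G x \<inter> neighbours G y) = 1"
          using mu_card[of x y] that dominates_verts mu1 by blast
        then show False using two[OF that(1-5)] by simp
      qed
      have no4: "\<nexists>p. cycle p \<and> length p = 4"
      proof
        assume "\<exists>p. cycle p \<and> length p = 4"
        then obtain a b c e where "distinct [a, b, c, e]" "a \<rightarrow>\<^bsub>G\<^esub> b" "b \<rightarrow>\<^bsub>G\<^esub> c" "c \<rightarrow>\<^bsub>G\<^esub> e" "e \<rightarrow>\<^bsub>G\<^esub> a"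
          unfolding ex_cycle_length_4_iff by blast
        then show False using no_square[of a b c e] dominates_sym by auto
      qed
      \<comment> \<open>The degree is at least 2, as seen at \<open>w\<close>, so \<open>u\<close>
        has a neighbour \<open>y\<close> besides \<open>w\<close>. It is not adjacent to
        \<open>v\<close>, or \<open>u\<close>, \<open>w\<close>, \<open>v\<close>, \<open>y\<close>
        would form a square; a common neighbour \<open>z\<close> of \<open>v\<close> and
        \<open>y\<close> completes the pentagon.\<close>
      have "{u, v} \<subseteq> neighbours G w" using w by (simp add: neighbours_def dominates_sym)
      from card_mono[OF finite_neighbours this] have "2 \<le> card (neighbours G w)" using uv by simp
      then have "2 \<le> card (neighbours G u)"
        using srg uv(1) dominates_verts(2)[OF w(1)] by (simp add: strongly_regular_def)
      then have "\<not> neighbours G u \<subseteq> {w}" using card_mono[of "{w}" "neighbours G u"] by auto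
      then obtain y where y: "u \<rightarrow>\<^bsub>G\<^esub> y" "y \<noteq> w" by (auto simp: neighbours_def)
      have vy: "v \<noteq> y" using y uv by auto
      have nvy: "\<not> v \<rightarrow>\<^bsub>G\<^esub> y"
        using no_square[of u w v y] w y uv dominates_sym by blast
      obtain z where z: "v \<rightarrow>\<^bsub>G\<^esub> z" "z \<rightarrow>\<^bsub>G\<^esub> y"
        using strongly_regular_common_neighbour[OF srg mu uv(2) dominates_verts(2)[OF y(1)] vy nvy]
        by blast
      have "w \<noteq> z" using no_triangle[OF w(1) _ dominates_sym[OF y(1)]] z(2) by blast
      moreover have "u \<noteq> z" using z(1) uv(4) dominates_sym by blast
      ultimately have "distinct [w, u, y, z, v]"
        using w y z uv(3) vy dominates_irrefl by auto
      then have "\<exists>p. cycle p \<and> length p = 5"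
        by (rule ex_cycle_length_5) (use w y z in \<open>auto intro: dominates_sym\<close>)
      moreover have "\<nexists>p. cycle p \<and> length p = l" if "3 \<le> l" "l < 5" for l
        using that no3 no4 by (cases "l = 3"; cases "l = 4") auto
      ultimately show ?thesis using lam False girth_eqI[of G 5] by (simp add: numeral_eq_enat)
    qed
  qed
qed

theorem theorem4p28:
  fixes G :: "('a, 'b) pre_digraph" and H :: "('c, 'd) pre_digraph"
    and n d lam mu :: nat
  assumes "strongly_regular G n d lam mu"
    and "Digraph_Component.connected G"
    and "graph H"
    and "adjacency_spectrum H = adjacency_spectrum G"
  shows "strongly_regular H n d lam mu \<and>
    lovasz_theta H = lovasz_theta G \<and>
    num_edges H = num_edges G \<and>
    num_triangles H = num_triangles G \<and>
    girth H = girth G \<and>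
    diameter H = diameter G"
proof -
  have H: "strongly_regular H n d lam mu"
    by (rule strongly_regular_cospectral[OF assms(1,3,4)])
  \<comment> \<open>Connectedness enters as positivity of \<open>mu\<close>, a condition on the
    parameters and thus shared by \<open>H\<close>.\<close>
  have mu: "0 < mu" by (rule strongly_regular_connected_imp_mu_pos[OF assms(1,2)])
  \<comment> \<open>The equations for \<open>r\<close> and \<open>s\<close> involve only the
    parameters, so one choice serves both graphs.\<close>
  obtain r s :: real
    where rs: "r + s = real lam - mu" "r * s = real mu - d" "0 \<le> r" "s < 0"
    by (rule strongly_regular_eigenvalues[OF assms(1)])
  show ?thesis
    using H lovasz_theta_strongly_regular[OF assms(1) rs] lovasz_theta_strongly_regular[OF H rs]
      strongly_regular_num_edges[OF assms(1)] strongly_regular_num_edges[OF H]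
      strongly_regular_num_triangles[OF assms(1)] strongly_regular_num_triangles[OF H]
      strongly_regular_girth[OF assms(1) mu] strongly_regular_girth[OF H mu]
      strongly_regular_diameter[OF assms(1) mu] strongly_regular_diameter[OF H mu]
    by simp
qed

end
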